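(* Let $\omega$ be a weight function with class $\overline\omega=\{\lambda\omega:\lambda>0\}$, and assume $\limsup_{t\to\infty}\frac{\omega(t)}{t^2}<\frac12$. There exist $\overline{C}<\infty$, depending only on $\overline\omega$, and $C<\infty$ (which may depend on $\omega$), such that for all $\rho$ (positive semi-definite Hermitian operators on $L^2(\mathbb{R})$ that diagonalize in an orthonormal basis), $$\sup_{q,p\in\mathbb{R}}|\Phi_\rho(q,p)|\,e^{2(\omega(|q|)+\omega(|p|))}\ \le\ C\,\sup_{m,n\in\mathbb{N}}|\rho_{m,n}|\,e^{\overline{C}(\omega(\sqrt m)+\omega(\sqrt n))}.$$
   Context: Weight function: a continuous increasing function $\omega:[0,\infty)\to[0,\infty)$ such that (i) $t\mapsto\omega(e^t)$ is convex; (ii) $\log t = o(\omega(t))$ as $t\to\infty$; (iii) $\omega(2t)=O(\omega(t))$ as $t\to\infty$; (iv) $\limsup_{t\to\infty}\omega(t)/t^2\le \frac12$. Hermite functions: $h_m(x)=(2^m m!\sqrt\pi)^{-1/2}H_m(x)e^{-x^2/2}$ with $H_m(x)=(-1)^m e^{x^2}\frac{d^m}{dx^m}e^{-x^2}$, $m\in\mathbb{N}=\{0,1,2,\dots\}$; they form an orthonormal basis of $L^2(\mathbb{R})$. Let $\rho=\sum_i \mathbf{p}_i\langle\cdot,\psi_i\rangle\psi_i$ be a positive semi-definite Hermitian operator on $L^2(\mathbb{R})$ that diagonalizes in an orthonormal basis $(\psi_i)$ with eigenvalues $\mathbf{p}_i\geq 0$. Its Wigner distribution is $$\Phi_\rho(q,p)=\sum_i\frac{\mathbf{p}_i}{2\pi}\int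 e^{ipx}\psi_i(q-\tfrac x2)\overline{\psi_i(q+\tfrac x2)}\,dx,$$ and $[\rho_{m,n}]$ is its (infinite) density matrix in the basis $(h_m)$, i.e. $\rho_{m,n}=\langle\rho h_n,h_m\rangle=\sum_i\mathbf{p}_i\langle\psi_i,h_m\rangle\overline{\langle\psi_i,h_n\rangle}$, so that $\Phi_\rho=\sum_{m,n}\rho_{m,n}\Phi_{m,n}$ where $\Phi_{m,n}(q,p)=\frac1{2\pi}\int e^{ipx}h_m(q-\tfrac x2)h_n(q+\tfrac x2)\,dx$. The inequality is understood to be trivially true when its right-hand side is infinite.
   Formalization: The constant C̄ is uniform only over members of the class whose limsup of ω(t)/t² is at most that of the given ω; when this limsup is positive, one C̄ for all members with limsup below 1/2 is impossible (e.g. at² with a→1/2 and thermal states). *)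

theory Defs
  imports "HOL-Analysis.Analysis" "HOL-Library.Landau_Symbols"
begin

section \<open>Weight functions\<close>

text \<open>A weight function lives on \<open>[0,\<infty>)\<close>; it is modelled by a function on \<open>real\<close> whose values
  on negative arguments are irrelevant.\<close>

definition quadratic_limsup :: "(real \<Rightarrow> real) \<Rightarrow> ereal" where
  "quadratic_limsup \<omega> = Limsup at_top (\<lambda>t. ereal (\<omega> t / t\<^sup>2))"

definition weight_function :: "(real \<Rightarrow> real) \<Rightarrow> bool" where
  "weight_function \<omega> \<longleftrightarrow>
     continuous_on {0..} \<omega> \<and>
     mono_on {0..} \<omega> \<and>
     (\<forall>t\<ge>0. 0 \<le> \<omega> t) \<and>
     convex_on UNIV (\<lambda>t. \<omega> (exp t)) \<and>
     ln \<in> o[at_top](\<omega>) \<and>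
     (\<lambda>t. \<omega> (2 * t)) \<in> O[at_top](\<omega>) \<and>
     quadratic_limsup \<omega> \<le> ereal (1 / 2)"

text \<open>The class of positive multiples of \<open>\<omega>\<close>, up to the irrelevant values on negative arguments.
  Its members need not satisfy the bound \<open>1/2\<close> on the quadratic limsup. Exponents that are uniform
  over a class have to be restricted by a bound below \<open>1/2\<close> on the limsup: for \<open>a * t\<^sup>2\<close> with
  \<open>a\<close> tending to \<open>1/2\<close>, the operators \<open>\<Sum>\<^sub>m c\<^sup>m \<langle>\<cdot>, h\<^sub>m\<rangle> h\<^sub>m\<close> with Gaussian Wigner distributions
  rule out a common one.\<close>

definition weight_class :: "(real \<Rightarrow> real) \<Rightarrow> (real \<Rightarrow> real) set" where
  "weight_class \<omega> = {\<eta>. \<exists>c>0. \<forall>t\<ge>0. \<eta> t = c * \<omega> t}"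


section \<open>Square-integrable functions on the real line\<close>

text \<open>Elements of \<open>L\<^sup>2(\<real>)\<close> are represented by Borel functions, without passing to the quotient by
  almost-everywhere equality; the notions below do not depend on the representative.
  The inner product is linear in its first argument.\<close>

definition L2_space :: "(real \<Rightarrow> complex) set" where
  "L2_space = {f \<in> borel_measurable lborel. integrable lborel (\<lambda>x. (cmod (f x))\<^sup>2)}"

definition L2_inner :: "(real \<Rightarrow> complex) \<Rightarrow> (real \<Rightarrow> complex) \<Rightarrow> complex" where
  "L2_inner f g = (LINT x|lborel. f x * cnj (g x))"

definition L2_norm :: "(real \<Rightarrow> complex) \<Rightarrow> real" where
  "L2_norm f = sqrt (LINT x|lborel. (cmod (f x))\<^sup>2)"

definition L2_sums :: "(nat \<Rightarrow> real \<Rightarrow> complex) \<Rightarrow> (real \<Rightarrow> complex) \<Rightarrow> bool" where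
  "L2_sums g f \<longleftrightarrow> (\<forall>i. g i \<in> L2_space) \<and> f \<in> L2_space \<and>
     (\<lambda>N. L2_norm (\<lambda>x. (\<Sum>i<N. g i x) - f x)) \<longlonglongrightarrow> 0"

text \<open>Since \<open>L\<^sup>2(\<real>)\<close> is separable and infinite-dimensional, every orthonormal basis can be indexed
  by \<open>nat\<close>.\<close>

definition L2_orthonormal_basis :: "(nat \<Rightarrow> real \<Rightarrow> complex) \<Rightarrow> bool" where
  "L2_orthonormal_basis \<psi> \<longleftrightarrow>
     (\<forall>i. \<psi> i \<in> L2_space) \<and>
     (\<forall>i j. L2_inner (\<psi> i) (\<psi> j) = (if i = j then 1 else 0)) \<and>
     (\<forall>f\<in>L2_space. L2_sums (\<lambda>i x. L2_inner f (\<psi> i) * \<psi> i x) f)"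


section \<open>Hermite functions\<close>

definition hermite_poly :: "nat \<Rightarrow> real \<Rightarrow> real" where
  "hermite_poly m x = (-1) ^ m * exp (x\<^sup>2) * (deriv ^^ m) (\<lambda>t. exp (- (t\<^sup>2))) x"

definition hermite_fun :: "nat \<Rightarrow> real \<Rightarrow> complex" where
  "hermite_fun m x =
     complex_of_real (hermite_poly m x * exp (- (x\<^sup>2) / 2) / sqrt (2 ^ m * fact m * sqrt pi))"


section \<open>Diagonalizable positive operators, Wigner distribution, density matrix\<close>

text \<open>\<open>\<rho> = \<Sum>\<^sub>i ev\<^sub>i \<langle>\<cdot>, \<psi>\<^sub>i\<rangle> \<psi>\<^sub>i\<close> on a domain \<open>D\<close>. Linearity, symmetry and positivity on \<open>D\<close>
  follow from the expansion. The case \<open>D = L2_space\<close> gives the everywhere defined (bounded)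
  operators; a proper \<open>D\<close> also admits unbounded ones.\<close>

definition diagonal_psd_operator ::
  "(real \<Rightarrow> complex) set \<Rightarrow> ((real \<Rightarrow> complex) \<Rightarrow> real \<Rightarrow> complex) \<Rightarrow>
     (nat \<Rightarrow> real) \<Rightarrow> (nat \<Rightarrow> real \<Rightarrow> complex) \<Rightarrow> bool" where
  "diagonal_psd_operator D \<rho> ev \<psi> \<longleftrightarrow>
     D \<subseteq> L2_space \<and>
     L2_orthonormal_basis \<psi> \<and>
     (\<forall>i. \<psi> i \<in> D) \<and>
     (\<forall>i. 0 \<le> ev i) \<and>
     (\<forall>f\<in>D. L2_sums (\<lambda>i x. complex_of_real (ev i) * L2_inner f (\<psi> i) * \<psi> i x) (\<rho> f))"

definition wigner :: "(nat \<Rightarrow> real) \<Rightarrow> (nat \<Rightarrow> real \<Rightarrow> complex) \<Rightarrow> real \<Rightarrow> real \<Rightarrow> complex" where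
  "wigner ev \<psi> q p =
     (\<Sum>i. complex_of_real (ev i / (2 * pi)) *
           (LINT x|lborel. cis (p * x) * \<psi> i (q - x / 2) * cnj (\<psi> i (q + x / 2))))"

definition density_matrix ::
  "((real \<Rightarrow> complex) \<Rightarrow> real \<Rightarrow> complex) \<Rightarrow> nat \<Rightarrow> nat \<Rightarrow> complex" where
  "density_matrix \<rho> m n = L2_inner (\<rho> (hermite_fun n)) (hermite_fun m)"

end

(* Expand each eigenfunction in Hermite functions, psi_i = sum_m c_{im} h_m. Its Wigner transform is then
   bounded by sum_{m,n} |c_{im}| |c_{in}| |Phi_{mn}|. The diagonal entry rho_{mm} equals
   sum_i p_i |c_{im}|^2, so the Cauchy-Schwarz inequality gives
   |Phi_rho| <= sum_{m,n} sqrt(rho_{mm} rho_{nn}) |Phi_{mn}|, and no off-diagonal entry is needed.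

   It remains to bound Phi_{mn}. With r^2 = q^2 + p^2 and s^2 = m + n + 1, the three-term recursion gives
   |Phi_{mn}| <= exp(- r^2 + 4 r s + s^2) up to a constant. As the weight is at most a t^2 + B with
   a < 1/2, this absorbs the weight when r >= R s for a large R depending only on a. When r <= R s, the
   trivial bound on Phi_{mn} suffices, since the doubling property gives
   omega(R s) <= K (omega(sqrt m) + omega(sqrt n)) + D. The remaining double series converges because
   log t = o(omega(t)). *)

theory Submission
  imports Defs "HOL-Probability.Levy" "HOL-Real_Asymp.Real_Asymp"
begin

section \<open>Hermite functions\<close>

text \<open>Expanding an eigenfunction under the Wigner integral needs completeness of the Hermite
  functions, which is derived from uniqueness of characteristic functions. A finite right-hand side
  makes the coefficients of every eigenfunction with positive eigenvalue absolutely summable, so its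
  series converges almost everywhere under an integrable majorant. The eigenvalues bring no
  summability of their own, as \<rho> may be unbounded; hence all interchanges are made in finite
  sums, with bounds that do not see the truncation.

  The strict inequality at 1/2 leaves a Gaussian reserve: of exp (- r^2) the weight consumes at most
  exp (2 a r^2), and the remaining (1 - 2 a) r^2 must beat 4 r s + s^2. This fixes R and with it the
  number of doublings. The exponent is uniform over the class because rescaling \<omega> changes
  only the additive constant in the doubling inequality, and additive constants end up in C.\<close>

primrec hpoly :: "nat \<Rightarrow> real poly" where
  "hpoly 0 = 1"
| "hpoly (Suc m) = [:0, 2:] * hpoly m - pderiv (hpoly m)"

text \<open>Differentiating the recursion reproduces it one degree lower. This is the source of the
  lowering operator. At m = 0 the factor 0 makes the truncated index \<open>m - 1\<close> harmless,
  a convention that recurs in all ladder formulas below.\<close>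

lemma pderiv_hpoly: "pderiv (hpoly m) = smult (2 * real m) (hpoly (m - 1))"
proof (induction m)
  case (Suc m)
  then show ?case
  proof (cases m)
    case (Suc k)
    have IH: "pderiv (hpoly (Suc k)) = smult (2 * real (Suc k)) (hpoly k)"
      using Suc.IH Suc by simp
    have "pderiv (hpoly (Suc (Suc k))) = pderiv [:0, 2:] * hpoly (Suc k)
        + [:0, 2:] * pderiv (hpoly (Suc k)) - pderiv (pderiv (hpoly (Suc k)))"
      by (simp only: hpoly.simps(2)[of "Suc k"] pderiv_diff pderiv_mult ac_simps)
    also have "\<dots> = smult 2 (hpoly (Suc k)) + smult (2 * real (Suc k)) ([:0, 2:] * hpoly k - pderiv (hpoly k))"
      unfolding IH pderiv_smult by (simp add: pderiv_pCons algebra_simps smult_diff_right one_pCons)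
    also have "\<dots> = smult 2 (hpoly (Suc k)) + smult (2 * real (Suc k)) (hpoly (Suc k))"
      by simp
    also have "\<dots> = smult (2 * real (Suc (Suc k))) (hpoly (Suc k))"
      by (simp only: smult_add_left[symmetric]) simp
    finally show ?thesis using Suc by simp
  qed (simp add: pderiv_pCons one_pCons)
qed simp

lemma hermite_poly_eq: "hermite_poly m x = poly (hpoly m) x"
proof -
  have "(deriv ^^ m) (\<lambda>t. exp (- (t\<^sup>2))) = (\<lambda>t. (- 1) ^ m * poly (hpoly m) t * exp (- (t\<^sup>2)))"
  proof (induction m)
    case (Suc m)
    have "((\<lambda>t. (- 1) ^ m * poly (hpoly m) t * exp (- (t\<^sup>2))) has_real_derivative
       (- 1) ^ Suc m * poly (hpoly (Suc m)) t * exp (- (t\<^sup>2))) (at t)" for t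
      by (auto intro!: derivative_eq_intros simp: algebra_simps)
    then show ?case
      unfolding funpow.simps comp_apply Suc by (intro ext DERIV_imp_deriv)
  qed simp
  then show ?thesis
    by (simp add: hermite_poly_def exp_minus field_simps flip: power_mult_distrib)
qed

section \<open>Normalised Hermite functions and their ladder relations\<close>

definition hnorm :: "nat \<Rightarrow> real" where
  "hnorm m = sqrt (2 ^ m * fact m * sqrt pi)"

text \<open>Hermite functions with real values, so that real derivatives and integrals apply;
  complex values enter only through \<open>hermite_fun_eq\<close>.\<close>

definition herm :: "nat \<Rightarrow> real \<Rightarrow> real" where
  "herm m x = poly (hpoly m) x * exp (- (x\<^sup>2) / 2) / hnorm m"

lemma hermite_fun_eq: "hermite_fun m x = complex_of_real (herm m x)"
  by (simp add: hermite_fun_def herm_def hermite_poly_eq hnorm_def)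

lemma hnorm_pos: "0 < hnorm m"
  by (simp add: hnorm_def)

lemma hnorm_Suc: "hnorm (Suc m) = sqrt (2 * real (Suc m)) * hnorm m"
  by (simp add: hnorm_def flip: real_sqrt_mult)

lemma herm_0: "herm 0 x = exp (- (x\<^sup>2) / 2) / sqrt (sqrt pi)"
  by (simp add: herm_def hnorm_def)

lemma poly_hpoly_lower: "poly (pderiv (hpoly m)) x * exp (- (x\<^sup>2) / 2) / hnorm m
  = sqrt (2 * real m) * herm (m - 1) x"
proof (cases m)
  case (Suc k)
  have "2 * real (Suc k) = sqrt (2 * real (Suc k)) * sqrt (2 * real (Suc k))"
    by simp
  then show ?thesis
    using hnorm_pos[of k] unfolding Suc pderiv_hpoly hnorm_Suc herm_def
    by (simp add: field_simps del: of_nat_Suc real_sqrt_mult)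
qed (simp add: herm_def)

lemma poly_hpoly_raise: "poly (hpoly (Suc m)) x * exp (- (x\<^sup>2) / 2) / hnorm m
  = sqrt (2 * real (Suc m)) * herm (Suc m) x"
  unfolding hnorm_Suc herm_def using hnorm_pos[of m] by simp

text \<open>Position is half the sum of the lowering and raising terms, and the derivative in
  \<open>herm_deriv\<close> is half their difference. Combining the two trades either term for a
  multiplication by x.\<close>

lemma herm_mult_x:
  "x * herm m x = (sqrt (2 * real m) * herm (m - 1) x + sqrt (2 * real (Suc m)) * herm (Suc m) x) / 2"
  unfolding poly_hpoly_lower[symmetric] poly_hpoly_raise[symmetric]
  using hnorm_pos[of m] by (simp add: herm_def field_simps)

lemma herm_deriv:
  "(herm m has_real_derivative
     (sqrt (2 * real m) * herm (m - 1) x - sqrt (2 * real (Suc m)) * herm (Suc m) x) / 2) (at x)"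
proof -
  have "((\<lambda>x. poly (hpoly m) x * exp (- (x\<^sup>2) / 2) / hnorm m) has_real_derivative
     (poly (pderiv (hpoly m)) x - x * poly (hpoly m) x) * exp (- (x\<^sup>2) / 2) / hnorm m) (at x)"
    using hnorm_pos[of m] by (auto intro!: derivative_eq_intros simp: field_simps)
  also have "(\<lambda>x. poly (hpoly m) x * exp (- (x\<^sup>2) / 2) / hnorm m) = herm m"
    by (auto simp: herm_def)
  also have "(poly (pderiv (hpoly m)) x - x * poly (hpoly m) x) * exp (- (x\<^sup>2) / 2) / hnorm m
    = sqrt (2 * real m) * herm (m - 1) x - x * herm m x"
    unfolding poly_hpoly_lower[symmetric] by (simp add: herm_def left_diff_distrib diff_divide_distrib)
  finally show ?thesis
    unfolding herm_mult_x by (simp add: field_simps)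
qed

section \<open>Continuity, Gaussian decay and square integrability\<close>

lemma continuous_on_herm [continuous_intros]:
  "continuous_on A f \<Longrightarrow> continuous_on A (\<lambda>x. herm m (f x))"
  unfolding herm_def using hnorm_pos[of m] by (auto intro!: continuous_intros)

lemma herm_borel_measurable [measurable]: "herm m \<in> borel_measurable borel"
  by (intro borel_measurable_continuous_onI continuous_intros)

text \<open>The rate \<epsilon> is arbitrary in the induction because each factor x uses up half of
  it.\<close>

lemma poly_exp_bound:
  fixes p :: "real poly"
  assumes "0 < \<epsilon>"
  shows "\<exists>C>0. \<forall>x. \<bar>poly p x\<bar> \<le> C * exp (\<epsilon> * \<bar>x\<bar>)"
  using assms
proof (induction p arbitrary: \<epsilon>)
  case 0
  then show ?case by (auto intro!: exI[of _ 1])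
next
  case (pCons a p)
  obtain C where C: "C > 0" "\<And>x. \<bar>poly p x\<bar> \<le> C * exp (\<epsilon> / 2 * \<bar>x\<bar>)"
    using pCons.IH[of "\<epsilon> / 2"] pCons.prems by auto
  have "\<bar>poly (pCons a p) x\<bar> \<le> (\<bar>a\<bar> + 2 / \<epsilon> * C) * exp (\<epsilon> * \<bar>x\<bar>)" for x
  proof -
    have "\<epsilon> / 2 * \<bar>x\<bar> \<le> exp (\<epsilon> / 2 * \<bar>x\<bar>)"
      using exp_ge_add_one_self[of "\<epsilon> / 2 * \<bar>x\<bar>"] by linarith
    then have x: "\<bar>x\<bar> \<le> 2 / \<epsilon> * exp (\<epsilon> / 2 * \<bar>x\<bar>)"
      using pCons.prems by (simp add: field_simps)
    have e: "exp (\<epsilon> / 2 * \<bar>x\<bar>) * exp (\<epsilon> / 2 * \<bar>x\<bar>) = exp (\<epsilon> * \<bar>x\<bar>)"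
      by (simp flip: exp_add)
    have "\<bar>poly (pCons a p) x\<bar> \<le> \<bar>a\<bar> + \<bar>x\<bar> * \<bar>poly p x\<bar>"
      by (simp flip: abs_mult)
    also have "\<bar>x\<bar> * \<bar>poly p x\<bar> \<le> (2 / \<epsilon> * exp (\<epsilon> / 2 * \<bar>x\<bar>)) * (C * exp (\<epsilon> / 2 * \<bar>x\<bar>))"
      by (intro mult_mono x C) (use pCons.prems C in auto)
    also have "\<dots> = 2 / \<epsilon> * C * exp (\<epsilon> * \<bar>x\<bar>)"
      unfolding e[symmetric] by simp
    also have "\<bar>a\<bar> \<le> \<bar>a\<bar> * exp (\<epsilon> * \<bar>x\<bar>)"
      using pCons.prems by (simp add: mult_le_cancel_left1)
    finally show ?thesis by (simp add: distrib_right)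
  qed
  moreover have "0 < \<bar>a\<bar> + 2 / \<epsilon> * C"
    using C pCons.prems by (auto intro: add_nonneg_pos)
  ultimately show ?case by blast
qed

lemma herm_bound:
  obtains C where "0 < C" "\<And>x. \<bar>herm m x\<bar> \<le> C * exp (- (x\<^sup>2) / 4)"
proof -
  obtain C where C: "C > 0" "\<And>x. \<bar>poly (hpoly m) x\<bar> \<le> C * exp (1 * \<bar>x\<bar>)"
    using poly_exp_bound[of 1 "hpoly m"] by auto
  have "\<bar>herm m x\<bar> \<le> (C * exp 1 / hnorm m) * exp (- (x\<^sup>2) / 4)" for x
  proof -
    \<comment> \<open>Half of the Gaussian exponent is given up to absorb the growth exp |x| of the
      polynomial factor.\<close>
    have "(\<bar>x\<bar> / 2 - 1)\<^sup>2 \<ge> 0" by simp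
    then have "\<bar>x\<bar> - x\<^sup>2 / 2 \<le> 1 - x\<^sup>2 / 4"
      by (simp add: power2_eq_square algebra_simps flip: abs_mult)
    then have "exp (\<bar>x\<bar> - x\<^sup>2 / 2) \<le> exp (1 - x\<^sup>2 / 4)" by simp
    then have e: "exp \<bar>x\<bar> * exp (- (x\<^sup>2) / 2) \<le> exp 1 * exp (- (x\<^sup>2) / 4)"
      by (simp flip: exp_add)
    have "\<bar>herm m x\<bar> = \<bar>poly (hpoly m) x\<bar> * exp (- (x\<^sup>2) / 2) / hnorm m"
      using hnorm_pos[of m] by (simp add: herm_def abs_mult)
    also have "\<dots> \<le> C * exp (1 * \<bar>x\<bar>) * exp (- (x\<^sup>2) / 2) / hnorm m"
      using hnorm_pos[of m] C by (intro divide_right_mono mult_right_mono) auto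
    also have "\<dots> = (C / hnorm m) * (exp \<bar>x\<bar> * exp (- (x\<^sup>2) / 2))"
      by simp
    also have "\<dots> \<le> (C / hnorm m) * (exp 1 * exp (- (x\<^sup>2) / 4))"
      using hnorm_pos[of m] C by (intro mult_left_mono e) auto
    finally show ?thesis by simp
  qed
  moreover have "0 < C * exp 1 / hnorm m"
    using C hnorm_pos[of m] by simp
  ultimately show ?thesis using that by blast
qed

lemma integrable_gauss: "integrable lborel (\<lambda>x::real. exp (- (x\<^sup>2) / 2))"
proof -
  have "integrable lborel (\<lambda>x. sqrt (2 * pi) * std_normal_density x)" by simp
  then show ?thesis by (simp add: std_normal_density_def)
qed

lemma integrable_herm_square: "integrable lborel (\<lambda>x. (herm m x)\<^sup>2)"
proof -
  obtain C where C: "0 < C" "\<And>x. \<bar>herm m x\<bar> \<le> C * exp (- (x\<^sup>2) / 4)"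
    using herm_bound by blast
  have "norm ((herm m x)\<^sup>2) \<le> norm (C\<^sup>2 * exp (- (x\<^sup>2) / 2))" for x
  proof -
    have "(herm m x)\<^sup>2 = \<bar>herm m x\<bar>\<^sup>2" by simp
    also have "\<dots> \<le> (C * exp (- (x\<^sup>2) / 4))\<^sup>2"
      by (intro power_mono C) auto
    also have "\<dots> = C\<^sup>2 * exp (- (x\<^sup>2) / 2)"
      by (simp add: power2_eq_square flip: exp_add)
    finally show ?thesis by simp
  qed
  then show ?thesis
    by (intro Bochner_Integration.integrable_bound[OF integrable_mult_right[OF integrable_gauss, of "C\<^sup>2"]]) auto
qed

lemma herm_tendsto_0:
  "(herm m \<longlongrightarrow> 0) at_top" "(herm m \<longlongrightarrow> 0) at_bot"
proof -
  obtain C where C: "0 < C" "\<And>x. \<bar>herm m x\<bar> \<le> C * exp (- (x\<^sup>2) / 4)"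
    using herm_bound by blast
  have 1: "((\<lambda>x::real. C * exp (- (x\<^sup>2) / 4)) \<longlongrightarrow> 0) at_top"
    using C by real_asymp
  have 2: "((\<lambda>x::real. C * exp (- (x\<^sup>2) / 4)) \<longlongrightarrow> 0) at_bot"
    using C by real_asymp
  show "(herm m \<longlongrightarrow> 0) at_top"
    by (rule Lim_null_comparison[OF _ 1]) (use C in auto)
  show "(herm m \<longlongrightarrow> 0) at_bot"
    by (rule Lim_null_comparison[OF _ 2]) (use C in auto)
qed

text \<open>The bound \<open>2 |a b| \<le> |a|\<^sup>2 + |b|\<^sup>2\<close> takes the place of the Cauchy-Schwarz inequality.\<close>

lemma integrable_mult_of_squares:
  fixes f g :: "'a \<Rightarrow> 'b::{real_normed_div_algebra,second_countable_topology,banach}"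
  assumes [measurable]: "f \<in> borel_measurable M" "g \<in> borel_measurable M"
    and f: "integrable M (\<lambda>x. (norm (f x))\<^sup>2)" and g: "integrable M (\<lambda>x. (norm (g x))\<^sup>2)"
  shows "integrable M (\<lambda>x. f x * g x)"
proof (rule Bochner_Integration.integrable_bound)
  show "integrable M (\<lambda>x. (norm (f x))\<^sup>2 + (norm (g x))\<^sup>2)"
    using f g by simp
  have "norm (f x) * norm (g x) \<le> (norm (f x))\<^sup>2 + (norm (g x))\<^sup>2" for x
  proof -
    have "2 * (norm (f x) * norm (g x)) \<le> (norm (f x))\<^sup>2 + (norm (g x))\<^sup>2"
      using zero_le_power2[of "norm (f x) - norm (g x)"] by (simp add: power2_eq_square algebra_simps)
    moreover have "0 \<le> norm (f x) * norm (g x)" by simp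
    ultimately show ?thesis by linarith
  qed
  then show "AE x in M. norm (f x * g x) \<le> norm ((norm (f x))\<^sup>2 + (norm (g x))\<^sup>2)"
    by (simp add: norm_mult)
qed simp

lemma integrable_herm_mult: "integrable lborel (\<lambda>x. herm m x * herm n x)"
  by (rule integrable_mult_of_squares) (auto simp: integrable_herm_square)

section \<open>Integration by parts and orthonormality\<close>

lemma integral_deriv_eq_0:
  fixes F f :: "real \<Rightarrow> 'a::euclidean_space"
  assumes F: "\<And>x. (F has_vector_derivative f x) (at x)"
    and f: "continuous_on UNIV f" "integrable lborel f"
    and lim: "(F \<longlongrightarrow> 0) at_top" "(F \<longlongrightarrow> 0) at_bot"
  shows "integral\<^sup>L lborel f = 0"
proof -
  have "(LBINT x=-\<infinity>..\<infinity>. f x) = 0 - 0"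
  proof (rule interval_integral_FTC_integrable)
    show "isCont f x" for x
      using f(1) by (simp add: continuous_on_eq_continuous_at)
    show "set_integrable lborel (einterval (- \<infinity>) \<infinity>) f"
      using f(2) by (simp add: einterval_eq_UNIV set_integrable_def)
    show "((F \<circ> real_of_ereal) \<longlongrightarrow> 0) (at_right (- \<infinity>))"
      "((F \<circ> real_of_ereal) \<longlongrightarrow> 0) (at_left \<infinity>)"
      using lim by (auto simp: ereal_tendsto_simps1)
  qed (auto intro: F)
  then show ?thesis
    by (simp add: interval_lebesgue_integral_def einterval_eq_UNIV set_lebesgue_integral_def)
qed

text \<open>Raising and lowering are adjoint to each other: the derivative of the product of two
  Hermite functions integrates to 0.\<close>

lemma integral_herm_shift:
  "sqrt (real (Suc m)) * (\<integral>x. herm (Suc m) x * herm n x \<partial>lborel)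
    = sqrt (real n) * (\<integral>x. herm m x * herm (n - 1) x \<partial>lborel)"
proof -
  define F where "F = (\<lambda>x. herm m x * herm n x)"
  define f where "f = (\<lambda>x. sqrt 2 * (sqrt (real n) * (herm m x * herm (n - 1) x)
     - sqrt (real (Suc m)) * (herm (Suc m) x * herm n x)))"
  have "(F has_real_derivative f x) (at x)" for x
  proof -
    define hm where "hm = (sqrt (2 * real m) * herm (m - 1) x - sqrt (2 * real (Suc m)) * herm (Suc m) x) / 2"
    define hn where "hn = (sqrt (2 * real n) * herm (n - 1) x - sqrt (2 * real (Suc n)) * herm (Suc n) x) / 2"
    have 1: "(F has_real_derivative hm * herm n x + herm m x * hn) (at x)"
      unfolding F_def by (rule derivative_eq_intros herm_deriv refl)+ (simp add: hm_def hn_def)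
    \<comment> \<open>One derivative is written with the raising term and the other with the
      lowering term, so that the two products with x cancel.\<close>
    have m: "hm = x * herm m x - sqrt (2 * real (Suc m)) * herm (Suc m) x"
      unfolding herm_mult_x hm_def by (simp add: field_simps)
    have n: "hn = sqrt (2 * real n) * herm (n - 1) x - x * herm n x"
      unfolding herm_mult_x hn_def by (simp add: field_simps)
    have "hm * herm n x + herm m x * hn = f x"
      unfolding m n f_def real_sqrt_mult by (simp add: algebra_simps del: of_nat_Suc)
    with 1 show ?thesis by simp
  qed
  moreover have "(F \<longlongrightarrow> 0) at_top" "(F \<longlongrightarrow> 0) at_bot"
    unfolding F_def using tendsto_mult[OF herm_tendsto_0(1)[of m] herm_tendsto_0(1)[of n]]
      tendsto_mult[OF herm_tendsto_0(2)[of m] herm_tendsto_0(2)[of n]] by auto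
  moreover have "continuous_on UNIV f"
    unfolding f_def by (intro continuous_intros)
  ultimately have "integral\<^sup>L lborel f = 0"
    by (intro integral_deriv_eq_0[of F])
       (auto simp: f_def integrable_herm_mult has_real_derivative_iff_has_vector_derivative)
  then show ?thesis
    by (simp add: f_def integrable_herm_mult)
qed

lemma integral_herm_0: "(\<integral>x. herm 0 x * herm 0 x \<partial>lborel) = 1"
proof -
  have "(\<integral>x. herm 0 x * herm 0 x \<partial>lborel) = (\<integral>x. normal_density 0 (1 / sqrt 2) x \<partial>lborel)"
    by (intro Bochner_Integration.integral_cong)
       (auto simp: normal_density_def herm_0 power_divide real_sqrt_mult mult_ac divide_simps
         simp flip: exp_add)
  then show ?thesis by simp
qed

text \<open>Adjointness lowers both indices together. When one of them reaches 0 before the other,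
  the factor sqrt 0 makes the integral vanish; otherwise the Gaussian integral remains.\<close>

lemma herm_orthonormal: "(\<integral>x. herm m x * herm n x \<partial>lborel) = (if m = n then 1 else 0)"
proof (induction m arbitrary: n)
  case 0
  have "(\<integral>x. herm n x * herm 0 x \<partial>lborel) = 0" if "n \<noteq> 0"
    using integral_herm_shift[of "n - 1" 0] that by (auto simp del: of_nat_Suc)
  then show ?case by (auto simp: integral_herm_0 mult.commute)
next
  case (Suc m)
  have "sqrt (real (Suc m)) * (\<integral>x. herm (Suc m) x * herm n x \<partial>lborel)
     = sqrt (real n) * (if m = n - 1 then 1 else 0)"
    by (simp only: integral_herm_shift Suc)
  then show ?case by (cases n) (auto simp del: of_nat_Suc split: if_splits)
qed

lemma integral_herm_square: "(\<integral>x. (herm m x)\<^sup>2 \<partial>lborel) = 1"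
  using herm_orthonormal[of m m] by (simp add: power2_eq_square)

section \<open>Wigner transforms of Hermite functions\<close>

text \<open>The factor 1 / (2 pi) is left out and returns only in the final summation over
  eigenfunctions. The conjugation has no effect on Hermite functions, which are real.\<close>

definition cross_wigner :: "(real \<Rightarrow> complex) \<Rightarrow> (real \<Rightarrow> complex) \<Rightarrow> real \<Rightarrow> real \<Rightarrow> complex" where
  "cross_wigner f g q p = (LINT x|lborel. cis (p * x) * f (q - x / 2) * cnj (g (q + x / 2)))"

abbreviation herm_wigner :: "nat \<Rightarrow> nat \<Rightarrow> real \<Rightarrow> real \<Rightarrow> complex" where
  "herm_wigner m n \<equiv> cross_wigner (hermite_fun m) (hermite_fun n)"

lemma cnj_borel_measurable [measurable]: "cnj \<in> borel_measurable borel"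
  by (intro borel_measurable_continuous_onI continuous_intros)

lemma cis_borel_measurable [measurable]: "cis \<in> borel_measurable borel"
  by (intro borel_measurable_continuous_onI) (auto intro!: continuous_intros)

lemma L2_space_measurable [measurable_dest]: "f \<in> L2_space \<Longrightarrow> f \<in> borel_measurable borel"
  by (simp add: L2_space_def)

lemma L2_space_integrable: "f \<in> L2_space \<Longrightarrow> integrable lborel (\<lambda>x. (cmod (f x))\<^sup>2)"
  by (simp add: L2_space_def)

lemma hermite_fun_L2: "hermite_fun n \<in> L2_space"
  using integrable_herm_square[of n] unfolding L2_space_def
  by (auto simp: hermite_fun_eq[abs_def])

lemma integrable_L2_reflect:
  fixes f :: "real \<Rightarrow> real"
  assumes "integrable lborel f"
  shows "integrable lborel (\<lambda>x. f (q - x / 2))" "integrable lborel (\<lambda>x. f (q + x / 2))"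
  using lborel_integrable_real_affine[OF assms, of "- 1 / 2" q]
    lborel_integrable_real_affine[OF assms, of "1 / 2" q] by simp_all

lemma integral_L2_reflect:
  fixes f :: "real \<Rightarrow> real"
  shows "(\<integral>x. f (q - x / 2) \<partial>lborel) = 2 * (\<integral>x. f x \<partial>lborel)"
    "(\<integral>x. f (q + x / 2) \<partial>lborel) = 2 * (\<integral>x. f x \<partial>lborel)"
  using lborel_integral_real_affine[of "- 1 / 2" f q]
    lborel_integral_real_affine[of "1 / 2" f q] by simp_all

lemma integrable_cross_wigner:
  assumes f: "f \<in> L2_space" and g: "g \<in> L2_space"
  shows "integrable lborel (\<lambda>x. cis (p * x) * f (q - x / 2) * cnj (g (q + x / 2)))"
proof (rule Bochner_Integration.integrable_bound)
  note [measurable] = L2_space_measurable[OF f] L2_space_measurable[OF g]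
  show "integrable lborel (\<lambda>x. f (q - x / 2) * g (q + x / 2))"
    by (rule integrable_mult_of_squares)
       (auto intro: integrable_L2_reflect[OF L2_space_integrable[OF f]]
          integrable_L2_reflect[OF L2_space_integrable[OF g]])
  show "(\<lambda>x. cis (p * x) * f (q - x / 2) * cnj (g (q + x / 2))) \<in> borel_measurable lborel"
    by measurable
qed (simp add: norm_mult)

text \<open>The arithmetic-geometric mean inequality under the integral. For unit vectors the bound
  is 2, the same as from Cauchy-Schwarz, and it is attained by the ground state at the
  origin.\<close>

lemma norm_cross_wigner_le:
  assumes f: "f \<in> L2_space" and g: "g \<in> L2_space"
  shows "cmod (cross_wigner f g q p)
    \<le> (\<integral>x. (cmod (f x))\<^sup>2 \<partial>lborel) + (\<integral>x. (cmod (g x))\<^sup>2 \<partial>lborel)"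
proof -
  note i = integrable_L2_reflect[OF L2_space_integrable[OF f], of q]
    integrable_L2_reflect[OF L2_space_integrable[OF g], of q]
  have "cmod (cross_wigner f g q p)
    \<le> (\<integral>x. ((cmod (f (q - x / 2)))\<^sup>2 + (cmod (g (q + x / 2)))\<^sup>2) / 2 \<partial>lborel)"
    unfolding cross_wigner_def
  proof (rule Bochner_Integration.integral_norm_bound_integral)
    show "cmod (cis (p * x) * f (q - x / 2) * cnj (g (q + x / 2)))
      \<le> ((cmod (f (q - x / 2)))\<^sup>2 + (cmod (g (q + x / 2)))\<^sup>2) / 2" for x
      using zero_le_power2[of "cmod (f (q - x / 2)) - cmod (g (q + x / 2))"]
      by (simp add: norm_mult power2_eq_square algebra_simps)
  qed (use i integrable_cross_wigner[OF f g] in auto)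
  also have "\<dots> = (\<integral>x. (cmod (f x))\<^sup>2 \<partial>lborel) + (\<integral>x. (cmod (g x))\<^sup>2 \<partial>lborel)"
    using i by (simp add: integral_L2_reflect[of "\<lambda>x. (cmod (f x))\<^sup>2"]
        integral_L2_reflect[of "\<lambda>x. (cmod (g x))\<^sup>2"])
  finally show ?thesis .
qed

lemma norm_herm_wigner_le_2: "cmod (herm_wigner m n q p) \<le> 2"
  using norm_cross_wigner_le[OF hermite_fun_L2[of m] hermite_fun_L2[of n], of q p]
  by (simp add: hermite_fun_eq integral_herm_square)

text \<open>Substitute -x for x. This turns the column n = 0 of Wigner transforms into the row m =
  0, where the induction for the pointwise bound starts.\<close>

lemma cross_wigner_commute: "cross_wigner g f q p = cnj (cross_wigner f g q p)"
proof -
  have "cross_wigner g f q p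
    = (LINT x|lborel. cis (p * (0 + - 1 * x)) * g (q - (0 + - 1 * x) / 2) * cnj (f (q + (0 + - 1 * x) / 2)))"
    unfolding cross_wigner_def
    by (subst lborel_integral_real_affine[of "- 1" _ 0]) (simp, simp)
  also have "\<dots> = (LINT x|lborel. cnj (cis (p * x) * f (q - x / 2) * cnj (g (q + x / 2))))"
    by (intro Bochner_Integration.integral_cong) (auto simp: cis_cnj mult_ac)
  also have "\<dots> = cnj (cross_wigner f g q p)"
    unfolding cross_wigner_def by (rule Bochner_Integration.integral_cnj)
  finally show ?thesis .
qed

text \<open>This is the three-term recursion of the Laguerre functions. It is the integral of the derivative
  of the integrand, rewritten by means of the raising operator in the variable \<open>q - x / 2\<close>
  and the lowering operator in \<open>q + x / 2\<close>.\<close>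

lemma herm_wigner_Suc:
  "complex_of_real (sqrt (real (Suc m))) * herm_wigner (Suc m) n q p
    = complex_of_real (sqrt 2) * Complex q (- p) * herm_wigner m n q p
      - complex_of_real (sqrt (real n)) * herm_wigner m (n - 1) q p"
proof -
  define K where "K = (\<lambda>m n x. cis (p * x) * hermite_fun m (q - x / 2) * cnj (hermite_fun n (q + x / 2)))"
  define d where "d = (\<lambda>m x. (sqrt (2 * real m) * herm (m - 1) x - sqrt (2 * real (Suc m)) * herm (Suc m) x) / 2)"
  define f where "f = (\<lambda>x. (complex_of_real (sqrt 2 * sqrt (real (Suc m))) * K (Suc m) n x
    + complex_of_real (sqrt 2 * sqrt (real n)) * K m (n - 1) x
    - 2 * Complex q (- p) * K m n x) / 2)"
  have d: "(herm m has_real_derivative d m x) (at x)" for m x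
    unfolding d_def by (rule herm_deriv)
  have int: "integrable lborel (K m n)" for m n
    unfolding K_def by (intro integrable_cross_wigner hermite_fun_L2)
  have "integral\<^sup>L lborel f = 0"
  proof (rule integral_deriv_eq_0)
    fix x
    \<comment> \<open>With these two forms the chain-rule factors -1/2 and 1/2 make the
      multiplications by q - x/2 and q + x/2 add up to -q. The variable x drops out, and the phase
      contributes i p.\<close>
    have lower: "d m (q - x / 2) = (q - x / 2) * herm m (q - x / 2) - sqrt 2 * sqrt (real (Suc m)) * herm (Suc m) (q - x / 2)"
      using herm_mult_x[of "q - x / 2" m] unfolding d_def real_sqrt_mult by argo
    have raise: "d n (q + x / 2) = sqrt 2 * sqrt (real n) * herm (n - 1) (q + x / 2) - (q + x / 2) * herm n (q + x / 2)"
      using herm_mult_x[of "q + x / 2" n] unfolding d_def real_sqrt_mult by argo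
    have 1: "((\<lambda>x. herm m (q - x / 2)) has_real_derivative - d m (q - x / 2) / 2) (at x)"
      by (rule DERIV_chain'[of "\<lambda>x. q - x / 2" "- 1 / 2", THEN DERIV_cong])
         (auto intro!: derivative_eq_intros d)
    have 2: "((\<lambda>x. herm n (q + x / 2)) has_real_derivative d n (q + x / 2) / 2) (at x)"
      by (rule DERIV_chain'[of "\<lambda>x. q + x / 2" "1 / 2", THEN DERIV_cong])
         (auto intro!: derivative_eq_intros d)
    have 3: "((\<lambda>x. cis (p * x)) has_vector_derivative \<i> * of_real p * cis (p * x)) (at x)"
      using exp_scaleR_has_vector_derivative_right[of "\<i> * of_real p" x UNIV]
      unfolding cis_conv_exp by (simp add: scaleR_conv_of_real mult_ac)
    have "(K m n has_vector_derivative
       (cis (p * x) * of_real (herm m (q - x / 2))) * of_real (d n (q + x / 2) / 2)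
       + (cis (p * x) * of_real (- d m (q - x / 2) / 2)
         + \<i> * of_real p * cis (p * x) * of_real (herm m (q - x / 2))) * of_real (herm n (q + x / 2))) (at x)"
      unfolding K_def hermite_fun_eq complex_cnj_complex_of_real
      by (intro has_vector_derivative_mult 3 has_vector_derivative_of_real 1 2)
    also have "(cis (p * x) * of_real (herm m (q - x / 2))) * of_real (d n (q + x / 2) / 2)
       + (cis (p * x) * of_real (- d m (q - x / 2) / 2)
         + \<i> * of_real p * cis (p * x) * of_real (herm m (q - x / 2))) * of_real (herm n (q + x / 2))
       = f x"
    proof -
      \<comment> \<open>The product rule as an identity between independent complex symbols: primed
        letters are shifted Hermite values, and \<open>a\<close>, \<open>b\<close> the ladder
        coefficients.\<close>
      have *: "(c * h) * ((b * k' - (Q + X / 2) * k) / 2) + (c * (- ((Q - X / 2) * h - a * h') / 2) + \<i> * P * c * h) * k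
        = (a * (c * h' * k) + b * (c * h * k') - 2 * (Q - \<i> * P) * (c * h * k)) / 2"
        for c h h' k k' a b X Q P :: complex
        by (simp add: field_simps)
      have Qp: "Complex q (- p) = of_real q - \<i> * of_real p"
        by (simp add: complex_eq_iff)
      show ?thesis
        unfolding lower raise f_def K_def hermite_fun_eq Qp complex_cnj_complex_of_real
          of_real_mult *[where X = "of_real x", symmetric]
        by simp
    qed
    finally show "(K m n has_vector_derivative f x) (at x)" .
  next
    show "continuous_on UNIV f"
      unfolding f_def K_def hermite_fun_eq
      by (intro continuous_intros) auto
    show "integrable lborel f"
      unfolding f_def using int by simp
    have *: "(K m n \<longlongrightarrow> 0) F"
      if "((\<lambda>x. herm m (q - x / 2)) \<longlongrightarrow> 0) F" "((\<lambda>x. herm n (q + x / 2)) \<longlongrightarrow> 0) F" for F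
      by (rule tendsto_norm_zero_cancel)
         (use tendsto_mult[OF that[THEN tendsto_norm_zero]] in \<open>simp add: K_def norm_mult hermite_fun_eq\<close>)
    have "filterlim (\<lambda>x. q - x / 2) at_bot at_top" "filterlim (\<lambda>x. q - x / 2) at_top at_bot"
      "filterlim (\<lambda>x. q + x / 2) at_bot at_bot" "filterlim (\<lambda>x. q + x / 2) at_top at_top"
      by real_asymp+
    note lims = this
    show "(K m n \<longlongrightarrow> 0) at_top"
      by (rule *[OF filterlim_compose[OF herm_tendsto_0(2)] filterlim_compose[OF herm_tendsto_0(1)]]) (fact lims)+
    show "(K m n \<longlongrightarrow> 0) at_bot"
      by (rule *[OF filterlim_compose[OF herm_tendsto_0(1)] filterlim_compose[OF herm_tendsto_0(2)]]) (fact lims)+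
  qed
  then have "complex_of_real (sqrt 2 * sqrt (real (Suc m))) * integral\<^sup>L lborel (K (Suc m) n)
    + complex_of_real (sqrt 2 * sqrt (real n)) * integral\<^sup>L lborel (K m (n - 1))
    - 2 * Complex q (- p) * integral\<^sup>L lborel (K m n) = 0"
    using int by (simp add: f_def del: of_nat_Suc)
  then have "of_real (sqrt 2) * (of_real (sqrt (real (Suc m))) * herm_wigner (Suc m) n q p)
    = of_real (sqrt 2) * (of_real (sqrt 2) * Complex q (- p) * herm_wigner m n q p
      - of_real (sqrt (real n)) * herm_wigner m (n - 1) q p)"
    unfolding cross_wigner_def K_def
    by (simp add: algebra_simps del: of_nat_Suc) (simp flip: mult.assoc of_real_mult del: of_nat_Suc)
  then show ?thesis
    by (subst (asm) mult_left_cancel) auto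
qed

lemma herm_wigner_0: "herm_wigner 0 0 q p = of_real (2 * exp (- (q\<^sup>2 + p\<^sup>2)))"
proof -
  have "herm_wigner 0 0 q p = (LINT x|lborel. of_real (exp (- (q\<^sup>2)) / sqrt pi) * (cis (p * x) * of_real (exp (- (x\<^sup>2) / 4))))"
    unfolding cross_wigner_def
  proof (rule Bochner_Integration.integral_cong)
    fix x
    have "herm 0 (q - x / 2) * herm 0 (q + x / 2) = exp (- ((q - x / 2)\<^sup>2) / 2 + - ((q + x / 2)\<^sup>2) / 2) / sqrt pi"
      unfolding exp_add by (simp add: herm_0)
    also have "- ((q - x / 2)\<^sup>2) / 2 + - ((q + x / 2)\<^sup>2) / 2 = - (q\<^sup>2) + - (x\<^sup>2) / 4"
      by (simp add: power2_eq_square field_simps)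
    finally have "herm 0 (q - x / 2) * herm 0 (q + x / 2) = exp (- (q\<^sup>2)) / sqrt pi * exp (- (x\<^sup>2) / 4)"
      by (simp only: exp_add) simp
    then have "complex_of_real (herm 0 (q - x / 2)) * of_real (herm 0 (q + x / 2))
      = of_real (exp (- (q\<^sup>2)) / sqrt pi * exp (- (x\<^sup>2) / 4))"
      by (simp only: of_real_mult[symmetric])
    then show "cis (p * x) * hermite_fun 0 (q - x / 2) * cnj (hermite_fun 0 (q + x / 2)) =
      of_real (exp (- (q\<^sup>2)) / sqrt pi) * (cis (p * x) * of_real (exp (- (x\<^sup>2) / 4)))"
      by (simp add: hermite_fun_eq mult_ac)
  qed simp
  also have "\<dots> = of_real (exp (- (q\<^sup>2)) / sqrt pi) * (LINT x|lborel. cis (p * x) * of_real (exp (- (x\<^sup>2) / 4)))"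
    by simp
  \<comment> \<open>Dilating by sqrt 2 turns exp (- x^2 / 4) into the standard normal weight, whose
    Fourier transform is its characteristic function.\<close>
  also have "(LINT x|lborel. cis (p * x) * of_real (exp (- (x\<^sup>2) / 4)))
    = of_real (sqrt 2) * (LINT x|lborel. cis (p * (sqrt 2 * x)) * of_real (exp (- ((sqrt 2 * x)\<^sup>2) / 4)))"
    by (subst lborel_integral_real_affine[of "sqrt 2" _ 0]) (auto simp: scaleR_conv_of_real)
  also have "(LINT x|lborel. cis (p * (sqrt 2 * x)) * of_real (exp (- ((sqrt 2 * x)\<^sup>2) / 4)))
    = (LINT x|lborel. of_real (sqrt (2 * pi)) * (std_normal_density x *\<^sub>R iexp ((sqrt 2 * p) * x)))"
    by (intro Bochner_Integration.integral_cong)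
       (auto simp: std_normal_density_def cis_conv_exp scaleR_conv_of_real power_mult_distrib mult_ac)
  also have "\<dots> = of_real (sqrt (2 * pi)) * (LINT x|lborel. std_normal_density x *\<^sub>R iexp ((sqrt 2 * p) * x))"
    by (rule Bochner_Integration.integral_mult_right_zero)
  also have "(LINT x|lborel. std_normal_density x *\<^sub>R iexp ((sqrt 2 * p) * x))
    = char std_normal_distribution (sqrt 2 * p)"
    unfolding char_def by (subst integral_density) auto
  also have "of_real (sqrt (2 * pi)) * char std_normal_distribution (sqrt 2 * p)
    = of_real (sqrt (2 * pi) * exp (- (p\<^sup>2)))"
    by (simp add: char_std_normal_distribution power_mult_distrib)
  also have "of_real (exp (- (q\<^sup>2)) / sqrt pi) * (complex_of_real (sqrt 2) * of_real (sqrt (2 * pi) * exp (- (p\<^sup>2))))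
    = of_real ((sqrt 2 * sqrt 2) * (exp (- (q\<^sup>2)) * exp (- (p\<^sup>2))))"
    unfolding of_real_mult[symmetric] by (rule arg_cong[of _ _ of_real]) (simp add: real_sqrt_mult)
  also have "exp (- (q\<^sup>2)) * exp (- (p\<^sup>2)) = exp (- (q\<^sup>2 + p\<^sup>2))"
    by (simp flip: exp_add)
  finally show ?thesis by simp
qed

section \<open>Pointwise exponential bounds on the Wigner transforms\<close>

lemma power_div_fact_le_exp:
  fixes y :: real
  assumes "0 \<le> y"
  shows "y ^ n / fact n \<le> exp y"
proof -
  have "(\<Sum>i\<in>{n}. inverse (fact i) *\<^sub>R y ^ i) \<le> (\<Sum>i. inverse (fact i) *\<^sub>R y ^ i)"
    by (rule sum_le_suminf[OF summable_exp_generic]) (use assms in auto)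
  then show ?thesis by (simp add: exp_def divide_inverse mult.commute)
qed

text \<open>The recursion for the bound \<open>b\<close> is \<open>(m + 1) b (m + 1) n = x b m n + b m (n - 1)\<close>;
  for every \<open>t > 0\<close> it is solved by \<open>(x + t) ^ m / fact m * exp (x * t) / t ^ n\<close>.\<close>

lemma norm_herm_wigner_le_aux:
  fixes q p t :: real
  assumes t: "0 < t"
  defines "x \<equiv> sqrt 2 * sqrt (q\<^sup>2 + p\<^sup>2)"
  shows "cmod (herm_wigner m n q p) \<le> 2 * exp (- (q\<^sup>2 + p\<^sup>2)) * sqrt (fact m) * sqrt (fact n) *
    ((x + t) ^ m / fact m * exp (x * t) / t ^ n)"
proof -
  have x0: "0 \<le> x" by (simp add: x_def)
  have z: "cmod (complex_of_real (sqrt 2) * Complex q (- p)) = x"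
    by (simp add: norm_mult x_def complex_norm)
  \<comment> \<open>In the column n = 0 the second term of the recursion vanishes, so the modulus is
    known exactly.\<close>
  have base: "cmod (herm_wigner m 0 q p) = 2 * exp (- (q\<^sup>2 + p\<^sup>2)) * x ^ m / sqrt (fact m)" for m
  proof (induction m)
    case (Suc m)
    have "sqrt (real (Suc m)) * cmod (herm_wigner (Suc m) 0 q p)
      = cmod (complex_of_real (sqrt (real (Suc m))) * herm_wigner (Suc m) 0 q p)"
      by (simp add: norm_mult)
    also have "\<dots> = x * cmod (herm_wigner m 0 q p)"
      unfolding herm_wigner_Suc using z by (simp add: norm_mult)
    finally show ?case
      unfolding Suc fact_Suc of_nat_mult real_sqrt_mult
      by (simp add: field_simps del: of_nat_Suc)
  qed (simp add: herm_wigner_0 norm_mult)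
  show ?thesis
  proof (induction m arbitrary: n)
    case 0
    \<comment> \<open>The row m = 0 is the origin of the factor exp (x t): a single term (x t)^n /
      n! is estimated by the whole exponential series.\<close>
    have "x ^ n / sqrt (fact n) = sqrt (fact n) * (x ^ n / fact n)"
      by (simp add: field_simps)
    also have "x ^ n / fact n = (x * t) ^ n / fact n / t ^ n"
      using t by (simp add: field_simps)
    also have "(x * t) ^ n / fact n \<le> exp (x * t)"
      using x0 t by (intro power_div_fact_le_exp) simp
    finally have "x ^ n / sqrt (fact n) \<le> sqrt (fact n) * (exp (x * t) / t ^ n)"
      using t by (simp add: divide_right_mono)
    then have "2 * exp (- (q\<^sup>2 + p\<^sup>2)) * (x ^ n / sqrt (fact n))
      \<le> 2 * exp (- (q\<^sup>2 + p\<^sup>2)) * (sqrt (fact n) * (exp (x * t) / t ^ n))"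
      by (intro mult_left_mono) auto
    then show ?case
      using base[of n] unfolding cross_wigner_commute[of "hermite_fun 0"] by (simp add: mult_ac)
  next
    case (Suc m)
    define A where "A = 2 * exp (- (q\<^sup>2 + p\<^sup>2))"
    define b where "b = (\<lambda>m n. (x + t) ^ m / fact m * exp (x * t) / t ^ n)"
    have IH: "cmod (herm_wigner m n q p) \<le> A * sqrt (fact m) * sqrt (fact n) * b m n" for n
      using Suc by (simp add: A_def b_def)
    have A0: "0 \<le> A" and b0: "0 \<le> b m n" for m n
      using x0 t by (auto simp: A_def b_def)
    define s where "s = sqrt (real (Suc m))"
    have s0: "0 < s" and s2: "real (Suc m) = s * s" and s_fact: "sqrt (fact (Suc m)) = s * sqrt (fact m)"
      by (simp_all add: s_def real_sqrt_mult)
    \<comment> \<open>Lowering n costs exactly one factor t in \<open>b\<close>; for n = 0 the left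
      side is 0.\<close>
    have low: "sqrt (real n) * (sqrt (fact (n - 1)) * b m (n - 1)) \<le> sqrt (fact n) * (t * b m n)"
    proof (cases n)
      case (Suc k)
      show ?thesis unfolding Suc fact_Suc of_nat_mult real_sqrt_mult
        using t by (simp add: b_def field_simps del: of_nat_Suc)
    qed (use t b0 in auto)
    have "sqrt (real (Suc m)) * cmod (herm_wigner (Suc m) n q p)
      = cmod (complex_of_real (sqrt (real (Suc m))) * herm_wigner (Suc m) n q p)"
      by (simp add: norm_mult)
    also have "\<dots> \<le> cmod (complex_of_real (sqrt 2) * Complex q (- p) * herm_wigner m n q p)
        + cmod (complex_of_real (sqrt (real n)) * herm_wigner m (n - 1) q p)"
      unfolding herm_wigner_Suc by (rule norm_triangle_ineq4)
    also have "\<dots> = x * cmod (herm_wigner m n q p) + sqrt (real n) * cmod (herm_wigner m (n - 1) q p)"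
      unfolding norm_mult[of _ "herm_wigner m n q p"] z by (simp add: norm_mult)
    also have "\<dots> \<le> x * (A * sqrt (fact m) * sqrt (fact n) * b m n)
        + sqrt (real n) * (A * sqrt (fact m) * sqrt (fact (n - 1)) * b m (n - 1))"
      using x0 by (intro add_mono mult_left_mono IH) auto
    also have "\<dots> = A * sqrt (fact m) * (x * (sqrt (fact n) * b m n) + sqrt (real n) * (sqrt (fact (n - 1)) * b m (n - 1)))"
      by (simp add: algebra_simps)
    also have "\<dots> \<le> A * sqrt (fact m) * (x * (sqrt (fact n) * b m n) + sqrt (fact n) * (t * b m n))"
      using A0 by (intro mult_left_mono add_left_mono low) auto
    also have "\<dots> = A * sqrt (fact m) * sqrt (fact n) * ((x + t) * b m n)"
      by (simp add: algebra_simps)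
    also have "(x + t) * b m n = real (Suc m) * b (Suc m) n"
      unfolding b_def fact_Suc of_nat_mult by (simp del: of_nat_Suc)
    finally have "s * cmod (herm_wigner (Suc m) n q p)
      \<le> s * (A * sqrt (fact (Suc m)) * sqrt (fact n) * b (Suc m) n)"
      unfolding s_def[symmetric] s2 s_fact using s0 by (simp add: mult_ac)
    then have "cmod (herm_wigner (Suc m) n q p) \<le> A * sqrt (fact (Suc m)) * sqrt (fact n) * b (Suc m) n"
      using s0 by simp
    then show ?case by (simp add: A_def b_def)
  qed
qed

text \<open>Take t = s in the preceding bound. Since s^2 dominates m + n, each root of a factorial
  is at most a power of s: one power cancels t^n, the other merges with (x + s)^m / m! into exp (s
  (x + s)). The summand 1 in s^2 keeps t positive at m = n = 0.\<close>

lemma norm_herm_wigner_le: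
  fixes q p :: real and m n :: nat
  defines "r \<equiv> sqrt (q\<^sup>2 + p\<^sup>2)" and "s \<equiv> sqrt (real m + real n + 1)"
  shows "cmod (herm_wigner m n q p) \<le> 2 * exp (- r\<^sup>2 + 4 * r * s + s\<^sup>2)"
proof -
  have r0: "0 \<le> r" by (simp add: r_def)
  have s0: "0 < s" by (simp add: s_def)
  have s2: "s\<^sup>2 = real m + real n + 1" by (simp add: s_def)
  define x where "x = sqrt 2 * r"
  have x0: "0 \<le> x" and x: "x \<le> 2 * r"
    using r0 by (auto simp: x_def intro!: mult_right_mono real_le_lsqrt)
  have fact_le: "sqrt (fact k) \<le> s ^ k" if "k \<le> m + n" for k
  proof -
    have "fact k \<le> real k ^ k"
      using fact_le_power[of k, where 'a = real] by simp
    also have "\<dots> \<le> (s\<^sup>2) ^ k"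
      using that by (intro power_mono) (auto simp: s2)
    finally have "sqrt (fact k) \<le> sqrt ((s ^ k)\<^sup>2)"
      by (simp flip: power_mult add: mult.commute)
    then show ?thesis using s0 by simp
  qed
  have "s ^ m * ((x + s) ^ m / fact m) = (s * (x + s)) ^ m / fact m"
    by (simp add: power_mult_distrib)
  also have "\<dots> \<le> exp (s * (x + s))"
    using s0 x0 by (intro power_div_fact_le_exp) auto
  finally have 1: "s ^ m * ((x + s) ^ m / fact m) \<le> exp (s * (x + s))" .
  have "cmod (herm_wigner m n q p) \<le> 2 * exp (- (q\<^sup>2 + p\<^sup>2)) * sqrt (fact m) * sqrt (fact n) *
    ((x + s) ^ m / fact m * exp (x * s) / s ^ n)"
    unfolding x_def r_def by (rule norm_herm_wigner_le_aux[OF s0])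
  also have "\<dots> \<le> 2 * exp (- (q\<^sup>2 + p\<^sup>2)) * s ^ m * s ^ n * ((x + s) ^ m / fact m * exp (x * s) / s ^ n)"
    using s0 x0 by (intro mult_right_mono mult_mono fact_le) auto
  also have "\<dots> = 2 * exp (- (q\<^sup>2 + p\<^sup>2)) * (s ^ m * ((x + s) ^ m / fact m)) * exp (x * s)"
    using s0 by simp
  also have "\<dots> \<le> 2 * exp (- (q\<^sup>2 + p\<^sup>2)) * exp (s * (x + s)) * exp (x * s)"
    by (intro mult_right_mono mult_left_mono 1) auto
  also have "\<dots> = 2 * exp (- (q\<^sup>2 + p\<^sup>2) + 2 * (x * s) + s\<^sup>2)"
    by (simp add: power2_eq_square algebra_simps flip: exp_add)
  also have "\<dots> \<le> 2 * exp (- r\<^sup>2 + 4 * r * s + s\<^sup>2)"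
    using mult_right_mono[OF x, of s] s0 by (simp add: r_def)
  finally show ?thesis .
qed

section \<open>Completeness of the Hermite functions\<close>

text \<open>The value at t = 0 shows that the positive and negative parts of g have equal mass.
  Normalised by it, they become probability densities with the same characteristic function, and
  Levy uniqueness applies.\<close>

lemma AE_eq_0_if_fourier_eq_0:
  fixes g :: "real \<Rightarrow> real"
  assumes g: "integrable lborel g"
    and fourier: "\<And>t. (LINT x|lborel. cis (t * x) * of_real (g x)) = 0"
  shows "AE x in lborel. g x = 0"
proof -
  have [measurable]: "g \<in> borel_measurable borel"
    using borel_measurable_integrable[OF g] by simp
  define u where "u = (\<lambda>x. max 0 (g x))"
  define v where "v = (\<lambda>x. max 0 (- g x))"
  have [measurable]: "u \<in> borel_measurable borel" "v \<in> borel_measurable borel"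
    by (auto simp: u_def v_def)
  have u: "integrable lborel u" and v: "integrable lborel v"
    unfolding u_def v_def using g by auto
  have nonneg: "0 \<le> u x" "0 \<le> v x" for x
    by (auto simp: u_def v_def)
  have g_eq: "g x = u x - v x" for x
    by (auto simp: u_def v_def)
  define c where "c = integral\<^sup>L lborel u"
  have "integral\<^sup>L lborel g = 0"
    using fourier[of 0] by simp
  then have c_v: "integral\<^sup>L lborel v = c"
    using u v unfolding g_eq[abs_def] by (simp add: c_def)
  show ?thesis
  \<comment> \<open>Normalisation needs positive mass; without mass both parts vanish almost
    everywhere.\<close>
  proof (cases "c = 0")
    case True
    have "AE x in lborel. u x = 0"
      using integral_nonneg_eq_0_iff_AE[OF u] nonneg True by (simp add: c_def)
    moreover have "AE x in lborel. v x = 0"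
      using integral_nonneg_eq_0_iff_AE[OF v] nonneg True by (simp add: c_v)
    ultimately show ?thesis
      by eventually_elim (simp add: g_eq)
  next
    case False
    have "0 \<le> c" unfolding c_def by (rule integral_nonneg_AE) (simp add: nonneg)
    with False have c: "0 < c" by simp
    have distr: "real_distribution (density lborel (\<lambda>x. ennreal (w x / c)))"
      if [measurable]: "w \<in> borel_measurable borel" and "integrable lborel w" "integral\<^sup>L lborel w = c"
        "\<And>x. 0 \<le> w x" for w
    proof -
      have "(\<integral>\<^sup>+x. ennreal (w x / c) \<partial>lborel) = ennreal (\<integral>x. w x / c \<partial>lborel)"
        using that c by (intro nn_integral_eq_integral) auto
      also have "\<dots> = 1" using that c by simp
      finally show ?thesis
        by (auto simp: real_distribution_def real_distribution_axioms_def emeasure_density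
            intro!: prob_spaceI)
    qed
    have char_eq: "char (density lborel (\<lambda>x. ennreal (w x / c))) t
        = (LINT x|lborel. cis (t * x) * of_real (w x)) / of_real c"
      if [measurable]: "w \<in> borel_measurable borel" and "\<And>x. 0 \<le> w x" for w t
    proof -
      have "char (density lborel (\<lambda>x. ennreal (w x / c))) t = (LINT x|lborel. (w x / c) *\<^sub>R cis (t * x))"
        unfolding char_def cis_conv_exp[symmetric] using that c by (subst integral_density) auto
      also have "\<dots> = (LINT x|lborel. (cis (t * x) * of_real (w x)) / of_real c)"
        by (intro Bochner_Integration.integral_cong) (auto simp: scaleR_conv_of_real)
      also have "\<dots> = (LINT x|lborel. cis (t * x) * of_real (w x)) / of_real c"
        by (rule Bochner_Integration.integral_divide_zero)
      finally show ?thesis .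
    qed
    have int_cis: "integrable lborel (\<lambda>x. cis (t * x) * of_real (w x))" if "integrable lborel w" for w t
      using borel_measurable_integrable[OF that]
      by (intro Bochner_Integration.integrable_bound[OF that]) (auto simp: norm_mult)
    have "(LINT x|lborel. cis (t * x) * of_real (u x)) = (LINT x|lborel. cis (t * x) * of_real (v x))" for t
      using fourier[of t] int_cis[OF u, of t] int_cis[OF v, of t]
      by (simp add: g_eq right_diff_distrib)
    then have "char (density lborel (\<lambda>x. ennreal (u x / c))) = char (density lborel (\<lambda>x. ennreal (v x / c)))"
      by (auto simp: char_eq nonneg)
    then have "density lborel (\<lambda>x. ennreal (u x / c)) = density lborel (\<lambda>x. ennreal (v x / c))"
      using u v c_v nonneg by (intro Levy_uniqueness distr) (auto simp: c_def)
    then have "AE x in lborel. ennreal (u x / c) = ennreal (v x / c)"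
      by (intro sigma_finite_measure.density_unique[OF lborel.sigma_finite_measure_axioms]) auto
    then show ?thesis
    proof eventually_elim
      case (elim x)
      then have "u x / c = v x / c"
        using c nonneg by (subst (asm) ennreal_inj) auto
      then show ?case using c by (simp add: g_eq)
    qed
  qed
qed

text \<open>By \<open>herm_mult_x\<close> a factor x replaces a Hermite function by its two
  neighbours, so the induction on k must treat all n at once. Only the moments against the Gaussian,
  n = 0, are used later.\<close>

lemma integral_herm_power_eq_0:
  fixes f :: "real \<Rightarrow> real"
  assumes "\<And>n. integrable lborel (\<lambda>x. f x * herm n x)" "\<And>n. (\<integral>x. f x * herm n x \<partial>lborel) = 0"
  shows "integrable lborel (\<lambda>x. f x * (x ^ k * herm n x)) \<and> (\<integral>x. f x * (x ^ k * herm n x) \<partial>lborel) = 0"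
proof (induction k arbitrary: n)
  case 0
  then show ?case using assms by simp
next
  case (Suc k)
  have "f x * (x ^ Suc k * herm n x) = sqrt (2 * real n) / 2 * (f x * (x ^ k * herm (n - 1) x))
    + sqrt (2 * real (Suc n)) / 2 * (f x * (x ^ k * herm (Suc n) x))" for x
  proof -
    have "f x * (x ^ Suc k * herm n x) = f x * x ^ k * (x * herm n x)" by simp
    then show ?thesis
      unfolding herm_mult_x by (simp add: field_simps del: of_nat_Suc)
  qed
  then show ?case
    using Suc.IH[of "n - 1"] Suc.IH[of "Suc n"] by (simp del: power_Suc of_nat_Suc)
qed

text \<open>Expanding exp (i t x) in powers of x shows that the Fourier transform of f times the
  Gaussian \<open>herm 0\<close> vanishes. The majorant |f| h_0 exp |t x| justifies termwise
  integration, and \<open>herm 0\<close> has no zeros.\<close>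

lemma herm_complete_real:
  fixes f :: "real \<Rightarrow> real"
  assumes [measurable]: "f \<in> borel_measurable borel" and sq: "integrable lborel (\<lambda>x. (f x)\<^sup>2)"
    and orth: "\<And>n. (\<integral>x. f x * herm n x \<partial>lborel) = 0"
  shows "AE x in lborel. f x = 0"
proof -
  have int: "integrable lborel (\<lambda>x. f x * herm n x)" for n
    by (rule integrable_mult_of_squares) (auto simp: sq integrable_herm_square)
  have int_exp: "integrable lborel (\<lambda>x. f x * (herm 0 x * exp (\<bar>t\<bar> * \<bar>x\<bar>)))" for t
  proof (rule integrable_mult_of_squares)
    have "norm ((norm (herm 0 x * exp (\<bar>t\<bar> * \<bar>x\<bar>)))\<^sup>2) \<le> norm (exp (2 * t\<^sup>2) / sqrt pi * exp (- (x\<^sup>2) / 2))" for x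
    proof -
      have e: "(exp z)\<^sup>2 = exp (2 * z)" for z :: real
        by (simp add: power2_eq_square mult_exp_exp)
      \<comment> \<open>This square is what remains when half of the exponent of h_0^2 pays for exp
        (2 |t x|).\<close>
      have "0 \<le> (\<bar>x\<bar> - 2 * \<bar>t\<bar>)\<^sup>2" by simp
      also have "\<dots> = x\<^sup>2 - 4 * (\<bar>t\<bar> * \<bar>x\<bar>) + 4 * t\<^sup>2"
        by (simp add: power2_diff power_mult_distrib mult_ac)
      finally have "2 * (- (x\<^sup>2) / 2) + 2 * (\<bar>t\<bar> * \<bar>x\<bar>) \<le> 2 * t\<^sup>2 + - (x\<^sup>2) / 2"
        by (simp add: field_simps)
      then have le: "exp (2 * (- (x\<^sup>2) / 2)) * exp (2 * (\<bar>t\<bar> * \<bar>x\<bar>)) \<le> exp (2 * t\<^sup>2) * exp (- (x\<^sup>2) / 2)"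
        unfolding mult_exp_exp exp_le_cancel_iff .
      have "(norm (herm 0 x * exp (\<bar>t\<bar> * \<bar>x\<bar>)))\<^sup>2 = exp (2 * (- (x\<^sup>2) / 2)) * exp (2 * (\<bar>t\<bar> * \<bar>x\<bar>)) / sqrt pi"
        unfolding herm_0 real_norm_def power2_abs power_mult_distrib power_divide e by simp
      also have "\<dots> \<le> exp (2 * t\<^sup>2) * exp (- (x\<^sup>2) / 2) / sqrt pi"
        by (intro divide_right_mono le) simp
      finally show ?thesis by simp
    qed
    then show "integrable lborel (\<lambda>x. (norm (herm 0 x * exp (\<bar>t\<bar> * \<bar>x\<bar>)))\<^sup>2)"
      by (intro Bochner_Integration.integrable_bound[OF integrable_mult_right[OF integrable_gauss, of "exp (2 * t\<^sup>2) / sqrt pi"]]) auto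
  qed (auto simp: sq)
  have "(LINT x|lborel. cis (t * x) * of_real (f x * herm 0 x)) = 0" for t
  proof -
    define s where "s = (\<lambda>N x. (\<Sum>k<N. ((\<i> * of_real t) ^ k / fact k) * of_real (f x * (x ^ k * herm 0 x))))"
    have s_eq: "s N x = of_real (f x * herm 0 x) * (\<Sum>k<N. (\<i> * of_real (t * x)) ^ k / fact k)" for N x
      unfolding s_def sum_distrib_left by (intro sum.cong refl) (simp add: power_mult_distrib)
    have "(\<lambda>N. integral\<^sup>L lborel (s N)) \<longlonglongrightarrow> (LINT x|lborel. cis (t * x) * of_real (f x * herm 0 x))"
    proof (rule integral_dominated_convergence)
      show "AE x in lborel. (\<lambda>N. s N x) \<longlonglongrightarrow> cis (t * x) * of_real (f x * herm 0 x)"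
      proof (rule AE_I2)
        fix x
        have "(\<lambda>k. (\<i> * complex_of_real (t * x)) ^ k / fact k) sums exp (\<i> * of_real (t * x))"
          using exp_converges[of "\<i> * of_real (t * x)"]
          by (simp add: scaleR_conv_of_real divide_inverse mult.commute)
        then show "(\<lambda>N. s N x) \<longlonglongrightarrow> cis (t * x) * of_real (f x * herm 0 x)"
          unfolding s_eq sums_def cis_conv_exp mult.commute[of "exp (\<i> * of_real (t * x))"]
          by (intro tendsto_mult_left)
      qed
      show "integrable lborel (\<lambda>x. norm (f x * (herm 0 x * exp (\<bar>t\<bar> * \<bar>x\<bar>))))"
        by (intro integrable_norm int_exp)
      show "AE x in lborel. norm (s N x) \<le> norm (f x * (herm 0 x * exp (\<bar>t\<bar> * \<bar>x\<bar>)))" for N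
      proof (rule AE_I2)
        fix x
        have "norm (\<Sum>k<N. (\<i> * complex_of_real (t * x)) ^ k / fact k) \<le> (\<Sum>k<N. (\<bar>t\<bar> * \<bar>x\<bar>) ^ k / fact k)"
          by (rule sum_norm_le) (simp add: norm_divide norm_power norm_mult abs_mult)
        also have "\<dots> \<le> exp (\<bar>t\<bar> * \<bar>x\<bar>)"
          unfolding exp_def
          by (subst divide_inverse, subst mult.commute, subst real_scaleR_def[symmetric])
             (rule sum_le_suminf[OF summable_exp_generic], auto)
        finally show "norm (s N x) \<le> norm (f x * (herm 0 x * exp (\<bar>t\<bar> * \<bar>x\<bar>)))"
          unfolding s_eq norm_mult norm_of_real by (simp add: abs_mult mult.assoc mult_left_mono)
      qed
    qed (simp_all add: s_def)
    moreover have "integral\<^sup>L lborel (s N) = 0" for N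
      using integral_herm_power_eq_0[of f _ 0, OF int orth]
      by (simp add: s_def Bochner_Integration.integral_sum complex_of_real_integrable_eq
          del: of_real_mult)
    ultimately show ?thesis
      by (simp add: LIMSEQ_const_iff)
  qed
  then have "AE x in lborel. f x * herm 0 x = 0"
    by (rule AE_eq_0_if_fourier_eq_0[OF int])
  then show ?thesis
    by eventually_elim (simp add: herm_0)
qed

lemma integrable_L2_mult_cnj:
  assumes "f \<in> L2_space" "g \<in> L2_space"
  shows "integrable lborel (\<lambda>x. f x * cnj (g x))"
  using assms L2_space_measurable[OF assms(1)] L2_space_measurable[OF assms(2)]
  by (intro integrable_mult_of_squares) (auto simp: L2_space_integrable)

lemma herm_complete:
  assumes f: "f \<in> L2_space" and orth: "\<And>n. L2_inner f (hermite_fun n) = 0"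
  shows "AE x in lborel. f x = 0"
proof -
  note [measurable] = L2_space_measurable[OF f]
  have int: "integrable lborel (\<lambda>x. f x * cnj (hermite_fun n x))" for n
    by (rule integrable_L2_mult_cnj[OF f hermite_fun_L2])
  have "AE x in lborel. Re (f x) = 0"
  proof (rule herm_complete_real)
    show "integrable lborel (\<lambda>x. (Re (f x))\<^sup>2)"
      by (intro Bochner_Integration.integrable_bound[OF L2_space_integrable[OF f]]) (auto simp: cmod_power2)
    show "(\<integral>x. Re (f x) * herm n x \<partial>lborel) = 0" for n
      using integral_Re[OF int[of n]] orth[of n] by (simp add: L2_inner_def hermite_fun_eq)
  qed simp
  moreover have "AE x in lborel. Im (f x) = 0"
  proof (rule herm_complete_real)
    show "integrable lborel (\<lambda>x. (Im (f x))\<^sup>2)"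
      by (intro Bochner_Integration.integrable_bound[OF L2_space_integrable[OF f]]) (auto simp: cmod_power2)
    show "(\<integral>x. Im (f x) * herm n x \<partial>lborel) = 0" for n
      using integral_Im[OF int[of n]] orth[of n] by (simp add: L2_inner_def hermite_fun_eq)
  qed simp
  ultimately show ?thesis
    by eventually_elim (simp add: complex_eq_iff)
qed

section \<open>Almost-everywhere convergence of Hermite expansions\<close>

lemma AE_lborel_affine:
  fixes c :: real
  assumes "c \<noteq> 0" and "AE x in lborel. P x"
  shows "AE x in lborel. P (t + c * x)"
proof -
  \<comment> \<open>\<open>P\<close> may fail to be measurable, so the substitution is carried out
    for the complement of a Borel null set.\<close>
  obtain N where N: "\<And>x. x \<in> space lborel - N \<Longrightarrow> P x" "N \<in> null_sets lborel"
    using AE_E3[OF assms(2)] by blast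
  have "AE x in lborel. x \<notin> N"
    using N(2) by (rule AE_not_in)
  moreover have "Measurable.pred borel (\<lambda>x. x \<notin> N)"
    using N(2) by (auto simp: null_sets_def)
  ultimately have "AE x in lborel. t + c * x \<notin> N"
    using AE_borel_affine[OF assms(1), of "\<lambda>x. x \<notin> N" t] by simp
  then show ?thesis
    by eventually_elim (use N(1) in auto)
qed

text \<open>Cauchy-Schwarz after splitting |c_n| into two square roots. The bound is uniform in N,
  and with h_n the value of the n-th Hermite function at x it is integrable in x: this is the
  majorant \<open>A\<close> used below.\<close>

lemma norm_sum_square_le:
  fixes c :: "nat \<Rightarrow> complex" and h :: "nat \<Rightarrow> real"
  assumes c: "summable (\<lambda>n. cmod (c n))" and h: "summable (\<lambda>n. cmod (c n) * (h n)\<^sup>2)"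
  shows "(cmod (\<Sum>n<N. c n * of_real (h n)))\<^sup>2 \<le> (\<Sum>n. cmod (c n)) * (\<Sum>n. cmod (c n) * (h n)\<^sup>2)"
proof -
  have "cmod (\<Sum>n<N. c n * of_real (h n)) \<le> (\<Sum>n<N. cmod (c n * of_real (h n)))"
    by (rule norm_sum)
  also have "\<dots> = (\<Sum>n<N. sqrt (cmod (c n)) * (sqrt (cmod (c n)) * \<bar>h n\<bar>))"
    by (intro sum.cong refl) (simp add: norm_mult flip: mult.assoc)
  finally have "(cmod (\<Sum>n<N. c n * of_real (h n)))\<^sup>2 \<le> (\<Sum>n<N. sqrt (cmod (c n)) * (sqrt (cmod (c n)) * \<bar>h n\<bar>))\<^sup>2"
    by (intro power_mono) auto
  also have "\<dots> \<le> (\<Sum>n<N. (sqrt (cmod (c n)))\<^sup>2) * (\<Sum>n<N. (sqrt (cmod (c n)) * \<bar>h n\<bar>)\<^sup>2)"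
    by (rule Cauchy_Schwarz_ineq_sum)
  also have "\<dots> = (\<Sum>n<N. cmod (c n)) * (\<Sum>n<N. cmod (c n) * (h n)\<^sup>2)"
    by (simp add: power_mult_distrib)
  also have "\<dots> \<le> (\<Sum>n. cmod (c n)) * (\<Sum>n. cmod (c n) * (h n)\<^sup>2)"
    by (intro mult_mono sum_le_suminf c h sum_nonneg suminf_nonneg) auto
  finally show ?thesis .
qed

lemma summable_mult_herm:
  fixes c :: "nat \<Rightarrow> complex" and h :: "nat \<Rightarrow> real"
  assumes c: "summable (\<lambda>n. cmod (c n))" and h: "summable (\<lambda>n. cmod (c n) * (h n)\<^sup>2)"
  shows "summable (\<lambda>n. c n * of_real (h n))"
proof (rule summable_norm_cancel, rule summable_comparison_test')
  show "summable (\<lambda>n. cmod (c n) + cmod (c n) * (h n)\<^sup>2)"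
    by (intro summable_add c h)
  fix n
  have "\<bar>h n\<bar> \<le> 1 + (h n)\<^sup>2"
    using zero_le_power2[of "\<bar>h n\<bar> - 1"] by (simp add: power2_diff)
  from mult_left_mono[OF this, of "cmod (c n)"]
  show "norm (norm (c n * complex_of_real (h n))) \<le> cmod (c n) + cmod (c n) * (h n)\<^sup>2"
    by (simp add: norm_mult distrib_left)
qed

text \<open>Every squared Hermite function has integral 1, so by monotone convergence the integrated
  series is the sum of the |c_n|.\<close>

lemma
  fixes c :: "nat \<Rightarrow> complex"
  assumes c: "summable (\<lambda>n. cmod (c n))"
  shows AE_summable_herm_square: "AE x in lborel. summable (\<lambda>n. cmod (c n) * (herm n x)\<^sup>2)"
    and integrable_suminf_herm_square: "integrable lborel (\<lambda>x. \<Sum>n. cmod (c n) * (herm n x)\<^sup>2)"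
proof -
  have int: "integrable lborel (\<lambda>x. cmod (c n) * (herm n x)\<^sup>2)" for n
    by (simp add: integrable_herm_square)
  have nn: "(\<integral>\<^sup>+x. ennreal (cmod (c n) * (herm n x)\<^sup>2) \<partial>lborel) = ennreal (cmod (c n))" for n
    using nn_integral_eq_integral[OF int[of n]] by (simp add: integral_herm_square)
  have "(\<integral>\<^sup>+x. (\<Sum>n. ennreal (cmod (c n) * (herm n x)\<^sup>2)) \<partial>lborel)
    = (\<Sum>n. \<integral>\<^sup>+x. ennreal (cmod (c n) * (herm n x)\<^sup>2) \<partial>lborel)"
    by (rule nn_integral_suminf) simp
  also have "\<dots> = (\<Sum>n. ennreal (cmod (c n)))"
    by (simp only: nn)
  also have "\<dots> \<noteq> \<infinity>"
    unfolding infinity_ennreal_def by (rule ennreal_suminf_neq_top[OF c]) simp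
  finally have "AE x in lborel. (\<Sum>n. ennreal (cmod (c n) * (herm n x)\<^sup>2)) \<noteq> \<infinity>"
    by (intro nn_integral_PInf_AE) auto
  then show *: "AE x in lborel. summable (\<lambda>n. cmod (c n) * (herm n x)\<^sup>2)"
    by eventually_elim (rule summable_suminf_not_top, auto)
  show "integrable lborel (\<lambda>x. \<Sum>n. cmod (c n) * (herm n x)\<^sup>2)"
    using c * by (intro integrable_suminf int) (auto simp: integral_herm_square)
qed

lemma L2_space_add:
  assumes f: "f \<in> L2_space" and g: "g \<in> L2_space"
  shows "(\<lambda>x. f x + g x) \<in> L2_space"
  unfolding L2_space_def
proof (intro CollectI conjI)
  note [measurable] = L2_space_measurable[OF f] L2_space_measurable[OF g]
  show "(\<lambda>x. f x + g x) \<in> borel_measurable lborel" by simp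
  have *: "(cmod (a + b))\<^sup>2 \<le> 2 * (cmod a)\<^sup>2 + 2 * (cmod b)\<^sup>2" for a b :: complex
  proof -
    have "(cmod (a + b))\<^sup>2 \<le> (cmod a + cmod b)\<^sup>2"
      by (intro power_mono norm_triangle_ineq) simp
    also have "\<dots> \<le> 2 * (cmod a)\<^sup>2 + 2 * (cmod b)\<^sup>2"
      using zero_le_power2[of "cmod a - cmod b"] by (simp add: power2_diff power2_sum)
    finally show ?thesis .
  qed
  have le: "AE x in lborel. norm ((cmod (f x + g x))\<^sup>2)
      \<le> norm (2 * (cmod (f x))\<^sup>2 + 2 * (cmod (g x))\<^sup>2)"
    unfolding real_norm_def abs_of_nonneg[OF zero_le_power2]
    by (intro AE_I2 order_trans[OF * abs_ge_self])
  show "integrable lborel (\<lambda>x. (cmod (f x + g x))\<^sup>2)"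
    by (rule Bochner_Integration.integrable_bound[OF _ _ le]) (simp_all add: L2_space_integrable f g)
qed

lemma L2_space_diff:
  assumes f: "f \<in> L2_space" and g: "g \<in> L2_space"
  shows "(\<lambda>x. f x - g x) \<in> L2_space"
proof -
  have "(\<lambda>x. - g x) \<in> L2_space"
    using g by (simp add: L2_space_def)
  from L2_space_add[OF f this] show ?thesis by simp
qed

lemma L2_space_sum:
  assumes "\<And>i. i \<in> I \<Longrightarrow> f i \<in> L2_space"
  shows "(\<lambda>x. \<Sum>i\<in>I. f i x) \<in> L2_space"
  using assms
proof (induction I rule: infinite_finite_induct)
  case (insert i I)
  then show ?case using L2_space_add[of "f i" "\<lambda>x. \<Sum>i\<in>I. f i x"] by simp
qed (simp_all add: L2_space_def)

text \<open>The series converges almost everywhere to some g in L^2. Dominated convergence shows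
  that g has the same coefficients as \<psi>, and completeness gives equality.\<close>

lemma AE_herm_expansion:
  assumes \<psi>: "\<psi> \<in> L2_space" and c: "summable (\<lambda>n. cmod (L2_inner \<psi> (hermite_fun n)))"
  shows "AE x in lborel. (\<lambda>N. \<Sum>n<N. L2_inner \<psi> (hermite_fun n) * hermite_fun n x) \<longlonglongrightarrow> \<psi> x"
proof -
  define c where "c = (\<lambda>n. L2_inner \<psi> (hermite_fun n))"
  have c: "summable (\<lambda>n. cmod (c n))" using c by (simp add: c_def)
  define A where "A = (\<lambda>x. (\<Sum>n. cmod (c n)) * (\<Sum>n. cmod (c n) * (herm n x)\<^sup>2))"
  define S where "S = (\<lambda>N x. \<Sum>n<N. c n * hermite_fun n x)"
  \<comment> \<open>\<open>lim\<close> is defined everywhere, which makes g measurable; its values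
    at points of divergence do not matter.\<close>
  define g where "g = (\<lambda>x. lim (\<lambda>N. S N x))"
  note [measurable] = L2_space_measurable[OF \<psi>]
  have herm_meas [measurable]: "hermite_fun n \<in> borel_measurable borel" for n
    by (rule L2_space_measurable[OF hermite_fun_L2])
  have S_meas [measurable]: "S N \<in> borel_measurable borel" for N
    by (simp add: S_def)
  have g_meas [measurable]: "g \<in> borel_measurable borel"
    by (simp add: g_def)
  have A: "integrable lborel A"
    unfolding A_def using integrable_suminf_herm_square[OF c] by simp
  have lim: "AE x in lborel. (\<lambda>N. S N x) \<longlonglongrightarrow> g x"
    using AE_summable_herm_square[OF c]
  proof eventually_elim
    case (elim x)
    then show ?case
      using summable_LIMSEQ[OF summable_mult_herm[OF c elim]]
      by (auto simp: g_def S_def hermite_fun_eq limI)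
  qed
  have S_le: "AE x in lborel. \<forall>N. (cmod (S N x))\<^sup>2 \<le> A x"
    using AE_summable_herm_square[OF c]
    by eventually_elim (auto simp: S_def A_def hermite_fun_eq intro!: norm_sum_square_le[OF c])
  have g_le: "AE x in lborel. (cmod (g x))\<^sup>2 \<le> A x"
    using S_le lim
  proof eventually_elim
    case (elim x)
    then have "(\<lambda>N. (cmod (S N x))\<^sup>2) \<longlonglongrightarrow> (cmod (g x))\<^sup>2"
      by (intro tendsto_intros)
    then show ?case
      by (rule LIMSEQ_le_const2) (use elim(1) in blast)
  qed
  have "g \<in> L2_space"
    unfolding L2_space_def
  proof (intro CollectI conjI)
    show "integrable lborel (\<lambda>x. (cmod (g x))\<^sup>2)"
      by (rule Bochner_Integration.integrable_bound[OF A]) (use g_le in \<open>auto elim!: eventually_mono\<close>)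
  qed simp
  have g_coeff: "L2_inner g (hermite_fun n) = c n" for n
  proof -
    have S_coeff: "(LINT x|lborel. S N x * cnj (hermite_fun n x)) = (if n < N then c n else 0)" for N
    proof -
      have "(LINT x|lborel. S N x * cnj (hermite_fun n x))
        = (LINT x|lborel. (\<Sum>k<N. c k * of_real (herm k x * herm n x)))"
        by (simp add: S_def sum_distrib_right hermite_fun_eq mult.assoc)
      also have "\<dots> = (\<Sum>k<N. c k * of_real (if k = n then 1 else 0))"
        unfolding herm_orthonormal[symmetric]
        by (subst Bochner_Integration.integral_sum)
           (simp_all add: complex_of_real_integrable_eq integrable_herm_mult del: of_real_mult)
      also have "\<dots> = (if n < N then c n else 0)"
        by (simp add: if_distrib[of of_real] if_distrib[of "(*) _"] cong: if_cong)
      finally show ?thesis .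
    qed
    have "(\<lambda>N. LINT x|lborel. S N x * cnj (hermite_fun n x)) \<longlonglongrightarrow> L2_inner g (hermite_fun n)"
      unfolding L2_inner_def
    proof (rule integral_dominated_convergence)
      show "integrable lborel (\<lambda>x. A x + (herm n x)\<^sup>2)"
        using A integrable_herm_square by simp
      show "AE x in lborel. (\<lambda>N. S N x * cnj (hermite_fun n x)) \<longlonglongrightarrow> g x * cnj (hermite_fun n x)"
        using lim by eventually_elim (intro tendsto_intros)
      show "AE x in lborel. norm (S N x * cnj (hermite_fun n x)) \<le> A x + (herm n x)\<^sup>2" for N
        using S_le
      proof eventually_elim
        case (elim x)
        have "cmod (S N x) * \<bar>herm n x\<bar> \<le> (cmod (S N x))\<^sup>2 + \<bar>herm n x\<bar>\<^sup>2"
        proof -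
          have "2 * (cmod (S N x) * \<bar>herm n x\<bar>) \<le> (cmod (S N x))\<^sup>2 + \<bar>herm n x\<bar>\<^sup>2"
            using zero_le_power2[of "cmod (S N x) - \<bar>herm n x\<bar>"] by (simp add: power2_diff)
          moreover have "0 \<le> cmod (S N x) * \<bar>herm n x\<bar>" by simp
          ultimately show ?thesis by linarith
        qed
        then show ?case
          using elim[rule_format, of N] by (simp add: norm_mult hermite_fun_eq)
      qed
    qed simp_all
    moreover have "(\<lambda>N. LINT x|lborel. S N x * cnj (hermite_fun n x)) \<longlonglongrightarrow> c n"
      unfolding S_coeff by (rule tendsto_eventually, rule eventually_sequentiallyI[of "Suc n"]) auto
    ultimately show ?thesis
      by (rule LIMSEQ_unique)
  qed
  have "AE x in lborel. \<psi> x - g x = 0"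
  proof (rule herm_complete)
    show "(\<lambda>x. \<psi> x - g x) \<in> L2_space"
      by (rule L2_space_diff) fact+
    show "L2_inner (\<lambda>x. \<psi> x - g x) (hermite_fun n) = 0" for n
      using g_coeff[of n] integrable_L2_mult_cnj[OF \<psi> hermite_fun_L2[of n]]
        integrable_L2_mult_cnj[OF \<open>g \<in> L2_space\<close> hermite_fun_L2[of n]]
      by (simp add: L2_inner_def c_def left_diff_distrib)
  qed
  with lim show ?thesis
    by eventually_elim (simp add: S_def c_def)
qed

text \<open>The same partial sum is put into both arguments, hence the square truncation. The
  integrand is dominated by A (q - x/2) + A (q + x/2).\<close>

lemma cross_wigner_expansion:
  assumes \<psi>: "\<psi> \<in> L2_space" and c: "summable (\<lambda>n. cmod (L2_inner \<psi> (hermite_fun n)))"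
  shows "(\<lambda>N. \<Sum>m<N. \<Sum>n<N. L2_inner \<psi> (hermite_fun m) * cnj (L2_inner \<psi> (hermite_fun n)) * herm_wigner m n q p)
    \<longlonglongrightarrow> cross_wigner \<psi> \<psi> q p"
proof -
  define c where "c = (\<lambda>n. L2_inner \<psi> (hermite_fun n))"
  have c': "summable (\<lambda>n. cmod (c n))" using c by (simp add: c_def)
  define A where "A = (\<lambda>x. (\<Sum>n. cmod (c n)) * (\<Sum>n. cmod (c n) * (herm n x)\<^sup>2))"
  define S where "S = (\<lambda>N x. \<Sum>n<N. c n * hermite_fun n x)"
  note [measurable] = L2_space_measurable[OF \<psi>]
  have herm_meas [measurable]: "hermite_fun n \<in> borel_measurable borel" for n
    by (rule L2_space_measurable[OF hermite_fun_L2])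
  have S_meas [measurable]: "S N \<in> borel_measurable borel" for N
    by (simp add: S_def)
  have A: "integrable lborel A"
    unfolding A_def using integrable_suminf_herm_square[OF c'] by simp
  have AE: "AE x in lborel. (\<lambda>N. S N x) \<longlonglongrightarrow> \<psi> x \<and> (\<forall>N. (cmod (S N x))\<^sup>2 \<le> A x)"
    using AE_herm_expansion[OF \<psi> c] AE_summable_herm_square[OF c']
    by eventually_elim (auto simp: S_def A_def hermite_fun_eq c_def intro!: norm_sum_square_le[OF c, folded c_def])
  have AE1: "AE x in lborel. (\<lambda>N. S N (q - x / 2)) \<longlonglongrightarrow> \<psi> (q - x / 2) \<and> (\<forall>N. (cmod (S N (q - x / 2)))\<^sup>2 \<le> A (q - x / 2))"
    and AE2: "AE x in lborel. (\<lambda>N. S N (q + x / 2)) \<longlonglongrightarrow> \<psi> (q + x / 2) \<and> (\<forall>N. (cmod (S N (q + x / 2)))\<^sup>2 \<le> A (q + x / 2))"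
    using AE_lborel_affine[OF _ AE, of "- 1 / 2" q] AE_lborel_affine[OF _ AE, of "1 / 2" q] by simp_all
  have "(\<lambda>N. cross_wigner (S N) (S N) q p) \<longlonglongrightarrow> cross_wigner \<psi> \<psi> q p"
    unfolding cross_wigner_def
  proof (rule integral_dominated_convergence)
    show "integrable lborel (\<lambda>x. A (q - x / 2) + A (q + x / 2))"
      using integrable_L2_reflect[OF A, of q] by simp
    show "AE x in lborel. (\<lambda>N. cis (p * x) * S N (q - x / 2) * cnj (S N (q + x / 2)))
      \<longlonglongrightarrow> cis (p * x) * \<psi> (q - x / 2) * cnj (\<psi> (q + x / 2))"
      using AE1 AE2 by eventually_elim (intro tendsto_intros, auto)
    show "AE x in lborel. norm (cis (p * x) * S N (q - x / 2) * cnj (S N (q + x / 2))) \<le> A (q - x / 2) + A (q + x / 2)" for N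
      using AE1 AE2
    proof eventually_elim
      case (elim x)
      define a b where "a = cmod (S N (q - x / 2))" and "b = cmod (S N (q + x / 2))"
      have "2 * (a * b) \<le> a\<^sup>2 + b\<^sup>2"
        using zero_le_power2[of "a - b"] by (simp add: power2_diff)
      moreover have "0 \<le> a * b" by (simp add: a_def b_def)
      moreover have "a\<^sup>2 \<le> A (q - x / 2)" "b\<^sup>2 \<le> A (q + x / 2)"
        using elim by (auto simp: a_def b_def)
      ultimately have "a * b \<le> A (q - x / 2) + A (q + x / 2)" by linarith
      then show ?case by (simp add: norm_mult a_def b_def)
    qed
  qed simp_all
  moreover have "cross_wigner (S N) (S N) q p = (\<Sum>m<N. \<Sum>n<N. c m * cnj (c n) * herm_wigner m n q p)" for N
  proof -
    have "cis (p * x) * S N (q - x / 2) * cnj (S N (q + x / 2)) =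
      (\<Sum>m<N. \<Sum>n<N. c m * cnj (c n) * (cis (p * x) * hermite_fun m (q - x / 2) * cnj (hermite_fun n (q + x / 2))))" for x
      by (simp add: S_def sum_distrib_left sum_distrib_right mult_ac)
    then show ?thesis
      unfolding cross_wigner_def
      by (simp add: Bochner_Integration.integral_sum integrable_cross_wigner hermite_fun_L2)
  qed
  ultimately show ?thesis
    by (simp add: c_def)
qed

section \<open>Diagonal entries of the density matrix\<close>

text \<open>The arithmetic-geometric mean inequality with weight \<open>L2_norm f + e\<close>; the
  summand e avoids division by 0. It is cruder than Cauchy-Schwarz, but tends to 0 with
  \<open>L2_norm f\<close> and e, which is all that continuity requires.\<close>

lemma norm_L2_inner_le:
  assumes f: "f \<in> L2_space" and h: "h \<in> L2_space" and e: "0 < e"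
  shows "cmod (L2_inner f h) \<le> (L2_norm f + e) * (1 + (L2_norm h)\<^sup>2) / 2"
proof -
  define a b where "a = L2_norm f" and "b = L2_norm h"
  have a0: "0 \<le> a"
    by (simp add: a_def L2_norm_def)
  have a: "a\<^sup>2 = (\<integral>x. (cmod (f x))\<^sup>2 \<partial>lborel)" and b: "b\<^sup>2 = (\<integral>x. (cmod (h x))\<^sup>2 \<partial>lborel)"
    by (simp_all add: a_def b_def L2_norm_def)
  have "cmod (L2_inner f h) \<le> (\<integral>x. ((cmod (f x))\<^sup>2 / (a + e) + (a + e) * (cmod (h x))\<^sup>2) / 2 \<partial>lborel)"
    unfolding L2_inner_def
  proof (rule Bochner_Integration.integral_norm_bound_integral)
    show "integrable lborel (\<lambda>x. f x * cnj (h x))"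
      by (rule integrable_L2_mult_cnj[OF f h])
    show "integrable lborel (\<lambda>x. ((cmod (f x))\<^sup>2 / (a + e) + (a + e) * (cmod (h x))\<^sup>2) / 2)"
      using L2_space_integrable[OF f] L2_space_integrable[OF h] by simp
    fix x
    define s where "s = sqrt (a + e)"
    have s: "0 < s" "s\<^sup>2 = a + e" using a0 e by (simp_all add: s_def)
    have "0 \<le> (cmod (f x) / s - s * cmod (h x))\<^sup>2" by simp
    also have "\<dots> = (cmod (f x))\<^sup>2 / (a + e) + (a + e) * (cmod (h x))\<^sup>2 - 2 * (cmod (f x) * cmod (h x))"
      using s(1) by (simp add: power2_diff power_divide power_mult_distrib flip: s(2))
    finally show "norm (f x * cnj (h x)) \<le> ((cmod (f x))\<^sup>2 / (a + e) + (a + e) * (cmod (h x))\<^sup>2) / 2"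
      by (simp add: norm_mult)
  qed
  also have "\<dots> = (a\<^sup>2 / (a + e) + (a + e) * b\<^sup>2) / 2"
    using L2_space_integrable[OF f] L2_space_integrable[OF h] by (simp add: a b)
  also have "a\<^sup>2 / (a + e) \<le> a + e"
  proof -
    have "a * a \<le> (a + e) * (a + e)" using a0 e by (intro mult_mono) auto
    then show ?thesis using a0 e by (simp add: field_simps power2_eq_square)
  qed
  finally show ?thesis
    by (simp add: a_def b_def distrib_left)
qed

lemma L2_sums_inner:
  assumes g: "L2_sums g f" and h: "h \<in> L2_space"
  shows "(\<lambda>N. \<Sum>i<N. L2_inner (g i) h) \<longlonglongrightarrow> L2_inner f h"
proof -
  have gi: "g i \<in> L2_space" and f: "f \<in> L2_space" for i
    using g by (auto simp: L2_sums_def)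
  define d where "d = (\<lambda>N x. (\<Sum>i<N. g i x) - f x)"
  have d: "d N \<in> L2_space" for N
    unfolding d_def by (intro L2_space_diff L2_space_sum gi f)
  have d_inner: "L2_inner (d N) h = (\<Sum>i<N. L2_inner (g i) h) - L2_inner f h" for N
    unfolding L2_inner_def d_def
    by (simp add: left_diff_distrib sum_distrib_right integrable_L2_mult_cnj gi f h Bochner_Integration.integral_sum)
  have "(\<lambda>N. L2_norm (d N)) \<longlonglongrightarrow> 0"
    using g by (simp add: L2_sums_def d_def)
  \<comment> \<open>The parameter e is taken as 1 / (N + 1), so that it vanishes along with the
    norm.\<close>
  from tendsto_mult_right[OF tendsto_add[OF this LIMSEQ_inverse_real_of_nat], of "(1 + (L2_norm h)\<^sup>2) / 2"]
  have "(\<lambda>N. (L2_norm (d N) + inverse (real (Suc N))) * (1 + (L2_norm h)\<^sup>2) / 2) \<longlonglongrightarrow> 0"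
    by simp
  then have "(\<lambda>N. L2_inner (d N) h) \<longlonglongrightarrow> 0"
    by (rule Lim_null_comparison[rotated]) (intro always_eventually allI norm_L2_inner_le[OF d h], simp)
  then show ?thesis
    unfolding d_inner by (simp add: LIM_zero_iff)
qed

lemma L2_inner_commute: "L2_inner g f = cnj (L2_inner f g)"
proof -
  have "cnj (L2_inner f g) = (LINT x|lborel. cnj (f x * cnj (g x)))"
    unfolding L2_inner_def by (rule Bochner_Integration.integral_cnj[symmetric])
  then show ?thesis by (simp add: L2_inner_def mult.commute)
qed

text \<open>Inner products pass to the limit in the expansion of \<rho>, so the diagonal entry is
  the limit of these sums. They increase with I, as their terms are nonnegative.\<close>

lemma sum_ev_le_density_matrix:
  assumes \<rho>: "diagonal_psd_operator D \<rho> \<alpha> \<psi>" and D: "hermite_fun m \<in> D"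
  shows "(\<Sum>i<I. \<alpha> i * (cmod (L2_inner (\<psi> i) (hermite_fun m)))\<^sup>2) \<le> cmod (density_matrix \<rho> m m)"
proof -
  let ?h = "hermite_fun m"
  have \<alpha>: "0 \<le> \<alpha> i" for i
    using \<rho> by (simp add: diagonal_psd_operator_def)
  have "L2_sums (\<lambda>i x. complex_of_real (\<alpha> i) * L2_inner ?h (\<psi> i) * \<psi> i x) (\<rho> ?h)"
    using \<rho> D by (simp add: diagonal_psd_operator_def)
  from L2_sums_inner[OF this hermite_fun_L2]
  have "(\<lambda>N. \<Sum>i<N. L2_inner (\<lambda>x. complex_of_real (\<alpha> i) * L2_inner ?h (\<psi> i) * \<psi> i x) ?h)
    \<longlonglongrightarrow> density_matrix \<rho> m m"
    by (simp add: density_matrix_def)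
  also have "(\<lambda>N. \<Sum>i<N. L2_inner (\<lambda>x. complex_of_real (\<alpha> i) * L2_inner ?h (\<psi> i) * \<psi> i x) ?h)
    = (\<lambda>N. of_real (\<Sum>i<N. \<alpha> i * (cmod (L2_inner (\<psi> i) ?h))\<^sup>2))"
  proof (intro ext, unfold of_real_sum, intro sum.cong refl)
    fix i
    have "L2_inner (\<lambda>x. complex_of_real (\<alpha> i) * L2_inner ?h (\<psi> i) * \<psi> i x) ?h
      = complex_of_real (\<alpha> i) * L2_inner ?h (\<psi> i) * L2_inner (\<psi> i) ?h"
      unfolding L2_inner_def[of _ ?h] by (simp add: mult.assoc)
    also have "\<dots> = of_real (\<alpha> i) * (L2_inner (\<psi> i) ?h * cnj (L2_inner (\<psi> i) ?h))"
      by (subst L2_inner_commute) simp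
    finally show "L2_inner (\<lambda>x. complex_of_real (\<alpha> i) * L2_inner ?h (\<psi> i) * \<psi> i x) ?h
      = of_real (\<alpha> i * (cmod (L2_inner (\<psi> i) ?h))\<^sup>2)"
      unfolding of_real_mult complex_norm_square .
  qed
  finally have "(\<lambda>N. cmod (of_real (\<Sum>i<N. \<alpha> i * (cmod (L2_inner (\<psi> i) ?h))\<^sup>2))) \<longlonglongrightarrow> cmod (density_matrix \<rho> m m)"
    by (rule tendsto_norm)
  then have "(\<lambda>N. \<Sum>i<N. \<alpha> i * (cmod (L2_inner (\<psi> i) ?h))\<^sup>2) \<longlonglongrightarrow> cmod (density_matrix \<rho> m m)"
    unfolding norm_of_real using \<alpha> by (simp add: abs_of_nonneg sum_nonneg)
  moreover have "incseq (\<lambda>N. \<Sum>i<N. \<alpha> i * (cmod (L2_inner (\<psi> i) ?h))\<^sup>2)"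
    using \<alpha> by (intro incseq_SucI) simp
  ultimately show ?thesis
    by (rule incseq_le[rotated])
qed

text \<open>Only the diagonal of the density matrix is needed: it controls the coefficients of all
  eigenfunctions, and by the Cauchy-Schwarz inequality also the sums
  \<open>\<Sum>i. \<alpha> i * |\<langle>\<psi> i, h m\<rangle>| * |\<langle>\<psi> i, h n\<rangle>|\<close>.\<close>

lemma norm_wigner_le:
  assumes \<rho>: "diagonal_psd_operator D \<rho> \<alpha> \<psi>" and D: "\<And>n. hermite_fun n \<in> D"
    and M: "0 \<le> M" and w: "\<And>n. 0 \<le> w n" "summable w"
    and dens: "\<And>n. cmod (density_matrix \<rho> n n) \<le> M * (w n)\<^sup>2"
    and K: "0 \<le> K" and v: "\<And>n. 0 \<le> v n" "summable v"
    and herm: "\<And>m n. cmod (herm_wigner m n q p) * (w m * w n) \<le> K * (v m * v n)"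
  shows "cmod (wigner \<alpha> \<psi> q p) \<le> M * K * (suminf v)\<^sup>2 / (2 * pi)"
proof -
  have \<alpha>: "0 \<le> \<alpha> i" and \<psi>: "\<psi> i \<in> L2_space" for i
    using \<rho> by (auto simp: diagonal_psd_operator_def L2_orthonormal_basis_def)
  define c where "c = (\<lambda>i n. L2_inner (\<psi> i) (hermite_fun n))"
  define T where "T = (\<lambda>i N. \<Sum>m<N. \<Sum>n<N. c i m * cnj (c i n) * herm_wigner m n q p)"
  define W where "W = (\<lambda>i. cross_wigner (\<psi> i) (\<psi> i) q p)"
  have diag: "(\<Sum>i<I. \<alpha> i * (cmod (c i n))\<^sup>2) \<le> M * (w n)\<^sup>2" for I n
    unfolding c_def using sum_ev_le_density_matrix[OF \<rho> D] dens by (rule order_trans)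
  \<comment> \<open>An eigenfunction with eigenvalue 0 is not controlled by the density matrix, and
    its expansion may fail to converge absolutely. The factor \<alpha> i removes that case;
    otherwise the diagonal bound gives |c_in| \<le> sqrt (M / \<alpha> i) w_n.\<close>
  have lim: "(\<lambda>N. cmod (of_real (\<alpha> i) * T i N)) \<longlonglongrightarrow> cmod (of_real (\<alpha> i) * W i)" for i
  proof (cases "\<alpha> i = 0")
    case False
    then have pos: "0 < \<alpha> i" using \<alpha>[of i] by simp
    have "cmod (c i n) \<le> sqrt (M / \<alpha> i) * w n" for n
    proof -
      have "\<alpha> i * (cmod (c i n))\<^sup>2 \<le> (\<Sum>i<Suc i. \<alpha> i * (cmod (c i n))\<^sup>2)"
        using \<alpha> by (intro member_le_sum) auto
      also have "\<dots> \<le> M * (w n)\<^sup>2" by (rule diag)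
      finally have "(cmod (c i n))\<^sup>2 \<le> (sqrt (M / \<alpha> i) * w n)\<^sup>2"
        using pos M by (simp add: power_mult_distrib field_simps)
      then show ?thesis
        by (rule power2_le_imp_le) (use M pos w in auto)
    qed
    then have "summable (\<lambda>n. cmod (c i n))"
      by (intro summable_comparison_test'[OF summable_mult[OF w(2)]]) auto
    then have "T i \<longlonglongrightarrow> W i"
      unfolding T_def W_def c_def by (rule cross_wigner_expansion[OF \<psi>])
    then show ?thesis
      by (intro tendsto_intros)
  qed simp
  have sq: "\<alpha> i * (a * b) = (sqrt (\<alpha> i) * a) * (sqrt (\<alpha> i) * b)" for i a b
  proof -
    have "(sqrt (\<alpha> i) * a) * (sqrt (\<alpha> i) * b) = (sqrt (\<alpha> i) * sqrt (\<alpha> i)) * (a * b)"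
      by (simp only: mult_ac)
    then show ?thesis using \<alpha>[of i] by simp
  qed
  have off_diag: "(\<Sum>i<I. \<alpha> i * (cmod (c i m) * cmod (c i n))) \<le> M * (w m * w n)" for I m n
  proof (rule power2_le_imp_le)
    have "(\<Sum>i<I. \<alpha> i * (cmod (c i m) * cmod (c i n)))\<^sup>2
      = (\<Sum>i<I. (sqrt (\<alpha> i) * cmod (c i m)) * (sqrt (\<alpha> i) * cmod (c i n)))\<^sup>2"
      by (simp only: sq)
    also have "\<dots> \<le> (\<Sum>i<I. (sqrt (\<alpha> i) * cmod (c i m))\<^sup>2) * (\<Sum>i<I. (sqrt (\<alpha> i) * cmod (c i n))\<^sup>2)"
      by (rule Cauchy_Schwarz_ineq_sum)
    also have "\<dots> = (\<Sum>i<I. \<alpha> i * (cmod (c i m))\<^sup>2) * (\<Sum>i<I. \<alpha> i * (cmod (c i n))\<^sup>2)"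
      using \<alpha> by (simp add: power_mult_distrib)
    also have "\<dots> \<le> (M * (w m)\<^sup>2) * (M * (w n)\<^sup>2)"
      using \<alpha> M by (intro mult_mono diag sum_nonneg) auto
    also have "\<dots> = (M * (w m * w n))\<^sup>2"
      by (simp add: power_mult_distrib power2_eq_square)
    finally show "(\<Sum>i<I. \<alpha> i * (cmod (c i m) * cmod (c i n)))\<^sup>2 \<le> (M * (w m * w n))\<^sup>2" .
  qed (use M w in auto)
  \<comment> \<open>Both truncations are kept here, so the sums may be reordered freely. The bound
    involves neither I nor N; the limit in N is taken next, then the one in I.\<close>
  have T_le: "(\<Sum>i<I. cmod (of_real (\<alpha> i) * T i N)) \<le> M * K * (suminf v)\<^sup>2" for I N
  proof -
    let ?H = "\<lambda>m n. cmod (herm_wigner m n q p)"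
    have "(\<Sum>i<I. cmod (of_real (\<alpha> i) * T i N))
      \<le> (\<Sum>i<I. \<Sum>m<N. \<Sum>n<N. ?H m n * (\<alpha> i * (cmod (c i m) * cmod (c i n))))"
    proof (rule sum_mono)
      fix i
      have "cmod (T i N) \<le> (\<Sum>m<N. \<Sum>n<N. cmod (c i m) * cmod (c i n) * ?H m n)"
        unfolding T_def by (intro sum_norm_le) (simp add: norm_mult)
      from mult_left_mono[OF this \<alpha>[of i]]
      show "cmod (of_real (\<alpha> i) * T i N) \<le> (\<Sum>m<N. \<Sum>n<N. ?H m n * (\<alpha> i * (cmod (c i m) * cmod (c i n))))"
        using \<alpha>[of i] by (simp add: norm_mult sum_distrib_left mult_ac)
    qed
    also have "\<dots> = (\<Sum>m<N. \<Sum>i<I. \<Sum>n<N. ?H m n * (\<alpha> i * (cmod (c i m) * cmod (c i n))))"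
      by (rule sum.swap)
    also have "\<dots> = (\<Sum>m<N. \<Sum>n<N. \<Sum>i<I. ?H m n * (\<alpha> i * (cmod (c i m) * cmod (c i n))))"
      by (intro sum.cong refl sum.swap)
    also have "\<dots> \<le> (\<Sum>m<N. \<Sum>n<N. M * K * (v m * v n))"
    proof (intro sum_mono)
      fix m n
      have "(\<Sum>i<I. ?H m n * (\<alpha> i * (cmod (c i m) * cmod (c i n)))) \<le> ?H m n * (M * (w m * w n))"
        unfolding sum_distrib_left[symmetric] by (intro mult_left_mono off_diag) simp
      also have "\<dots> = M * (?H m n * (w m * w n))" by simp
      \<comment> \<open>The decay of the coefficients is traded for the summable weights
        \<open>v\<close>, and the double sum factors into a square.\<close>
      also have "\<dots> \<le> M * (K * (v m * v n))" by (intro mult_left_mono herm M)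
      finally show "(\<Sum>i<I. ?H m n * (\<alpha> i * (cmod (c i m) * cmod (c i n)))) \<le> M * K * (v m * v n)"
        by simp
    qed
    also have "\<dots> = M * K * (\<Sum>m<N. v m)\<^sup>2"
      unfolding power2_eq_square sum_product by (simp only: sum_distrib_left)
    also have "\<dots> \<le> M * K * (suminf v)\<^sup>2"
      using M K v by (intro mult_left_mono power_mono sum_le_suminf sum_nonneg) auto
    finally show ?thesis .
  qed
  have "(\<Sum>i<I. cmod (of_real (\<alpha> i) * W i)) \<le> M * K * (suminf v)\<^sup>2" for I
    by (rule LIMSEQ_le_const2[OF tendsto_sum[OF lim]]) (use T_le in blast)
  then have W_le: "(\<Sum>i<I. cmod (of_real (\<alpha> i / (2 * pi)) * W i)) \<le> M * K * (suminf v)\<^sup>2 / (2 * pi)" for I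
    using divide_right_mono[of "\<Sum>i<I. cmod (of_real (\<alpha> i) * W i)" "M * K * (suminf v)\<^sup>2" "2 * pi"]
    by (simp add: norm_mult norm_divide sum_divide_distrib)
  have sm: "summable (\<lambda>i. cmod (of_real (\<alpha> i / (2 * pi)) * W i))"
    by (rule summableI_nonneg_bounded[OF _ W_le]) simp
  have "cmod (wigner \<alpha> \<psi> q p) = cmod (\<Sum>i. of_real (\<alpha> i / (2 * pi)) * W i)"
    by (simp add: wigner_def W_def cross_wigner_def)
  also have "\<dots> \<le> (\<Sum>i. cmod (of_real (\<alpha> i / (2 * pi)) * W i))"
    by (rule summable_norm[OF sm])
  also have "\<dots> \<le> M * K * (suminf v)\<^sup>2 / (2 * pi)"
    by (rule suminf_le_const[OF sm W_le])
  finally show ?thesis .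
qed

section \<open>Weight functions\<close>

lemma quadratic_bound:
  assumes mono: "mono_on {0..} \<eta>" and nonneg: "\<And>t. 0 \<le> t \<Longrightarrow> 0 \<le> \<eta> t"
    and lim: "quadratic_limsup \<eta> < ereal a" and a: "0 < a"
  obtains B where "0 \<le> B" "\<And>t. 0 \<le> t \<Longrightarrow> \<eta> t \<le> a * t\<^sup>2 + B"
proof -
  have "\<forall>\<^sub>F t in at_top. ereal (\<eta> t / t\<^sup>2) < ereal a"
    using lim unfolding quadratic_limsup_def by (rule Limsup_lessD)
  then obtain T where T: "\<And>t. T \<le> t \<Longrightarrow> \<eta> t / t\<^sup>2 < a"
    by (auto simp: eventually_at_top_linorder)
  \<comment> \<open>The lower bound 1 permits division by t^2 beyond the threshold; below it,
    monotonicity bounds the weight by its value there.\<close>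
  define T' where "T' = max T 1"
  have T'0: "0 \<le> \<eta> T'" by (rule nonneg) (simp add: T'_def)
  have "\<eta> t \<le> a * t\<^sup>2 + \<eta> T'" if t: "0 \<le> t" for t
  proof (cases "T' \<le> t")
    case True
    then have "0 < t" "\<eta> t / t\<^sup>2 < a" using T by (auto simp: T'_def)
    then have "\<eta> t \<le> a * t\<^sup>2" by (simp add: field_simps)
    then show ?thesis using T'0 by simp
  next
    case False
    then have "\<eta> t \<le> \<eta> T'"
      using t by (intro mono_onD[OF mono]) auto
    then show ?thesis using a by (simp add: add_increasing)
  qed
  then show ?thesis using that T'0 by blast
qed

text \<open>The factor K^k is explicit because it enters the uniform exponent; the additive constant
  is only absorbed into C.\<close>

lemma doubling_power:
  fixes \<eta> :: "real \<Rightarrow> real"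
  assumes dbl: "\<And>t. 0 \<le> t \<Longrightarrow> \<eta> (2 * t) \<le> K * \<eta> t + D" and K: "1 \<le> K"
  shows "\<exists>D'. \<forall>t\<ge>0. \<eta> (2 ^ k * t) \<le> K ^ k * \<eta> t + D'"
proof (induction k)
  case (Suc k)
  then obtain D' where D': "\<And>t. 0 \<le> t \<Longrightarrow> \<eta> (2 ^ k * t) \<le> K ^ k * \<eta> t + D'" by blast
  have "\<eta> (2 ^ Suc k * t) \<le> K ^ Suc k * \<eta> t + (K ^ k * D + D')" if "0 \<le> t" for t
  proof -
    have "\<eta> (2 ^ Suc k * t) \<le> K ^ k * \<eta> (2 * t) + D'"
      using D'[of "2 * t"] that by (simp add: mult_ac)
    also have "K ^ k * \<eta> (2 * t) \<le> K ^ k * (K * \<eta> t + D)"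
      using K by (intro mult_left_mono dbl that) auto
    finally show ?thesis by (simp add: algebra_simps)
  qed
  then show ?case by blast
qed (auto intro!: exI[of _ 0])

text \<open>Monotonicity extends the asymptotic bound to all t at the price of an additive constant.
  Enlarging the factor to at least 1 lets its powers be used as factors that are at least 1.\<close>

lemma weight_function_doubling:
  assumes "weight_function \<omega>"
  obtains K D where "1 \<le> K" "\<And>t. 0 \<le> t \<Longrightarrow> \<omega> (2 * t) \<le> K * \<omega> t + D"
proof -
  have mono: "mono_on {0..} \<omega>" and nonneg: "\<And>t. 0 \<le> t \<Longrightarrow> 0 \<le> \<omega> t"
    and big: "(\<lambda>t. \<omega> (2 * t)) \<in> O[at_top](\<omega>)"
    using assms by (auto simp: weight_function_def)
  obtain c where c: "\<forall>\<^sub>F t in at_top. norm (\<omega> (2 * t)) \<le> c * norm (\<omega> t)"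
    using big by (auto elim: landau_o.bigE)
  then obtain T where T: "\<And>t. T \<le> t \<Longrightarrow> norm (\<omega> (2 * t)) \<le> c * norm (\<omega> t)"
    by (auto simp: eventually_at_top_linorder)
  define T' where "T' = max T 0"
  have "\<omega> (2 * t) \<le> max c 1 * \<omega> t + \<omega> (2 * T')" if t: "0 \<le> t" for t
  proof (cases "T' \<le> t")
    case True
    then have "\<omega> (2 * t) \<le> c * \<omega> t"
      using T[of t] t nonneg[of t] nonneg[of "2 * t"] by (simp add: T'_def)
    also have "\<dots> \<le> max c 1 * \<omega> t"
      using nonneg[OF t] by (intro mult_right_mono) auto
    finally show ?thesis using nonneg[of "2 * T'"] by (simp add: T'_def)
  next
    case False
    then have "\<omega> (2 * t) \<le> \<omega> (2 * T')"
      using t by (intro mono_onD[OF mono]) auto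
    then show ?thesis using nonneg[OF t] by (simp add: add_increasing)
  qed
  then show ?thesis using that[of "max c 1" "\<omega> (2 * T')"] by simp
qed

text \<open>Eventually c \<omega>(t) \<ge> 4 ln t, and at t = sqrt n this makes the terms at most
  n^(-2).\<close>

lemma summable_exp_weight:
  assumes ln: "ln \<in> o[at_top](\<omega>)" and nonneg: "\<And>t. 0 \<le> t \<Longrightarrow> 0 \<le> \<omega> t" and c: "0 < c"
  shows "summable (\<lambda>n. exp (- (c * \<omega> (sqrt (real n)))))"
proof -
  have "\<forall>\<^sub>F t in at_top. norm (ln t :: real) \<le> c / 4 * norm (\<omega> t)"
    using landau_o.smallD[OF ln, of "c / 4"] c by simp
  moreover have "\<forall>\<^sub>F t in at_top. (1 :: real) \<le> t"
    by (rule eventually_ge_at_top)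
  ultimately have "\<forall>\<^sub>F t in at_top. exp (- (c * \<omega> t)) \<le> inverse (t ^ 4)"
  proof eventually_elim
    case (elim t)
    then have "4 * ln t \<le> c * \<omega> t" using nonneg[of t] by simp
    then have "exp (- (c * \<omega> t)) \<le> exp (- (4 * ln t))" by simp
    also have "\<dots> = inverse (exp (ln t) ^ 4)"
      by (simp add: exp_minus flip: exp_of_nat_mult)
    also have "exp (ln t) = t" using elim by simp
    finally show ?case .
  qed
  moreover have "filterlim (\<lambda>n. sqrt (real n)) at_top sequentially"
    by (rule filterlim_compose[OF sqrt_at_top filterlim_real_sequentially])
  ultimately have "\<forall>\<^sub>F n in sequentially. exp (- (c * \<omega> (sqrt (real n)))) \<le> inverse (sqrt (real n) ^ 4)"
    by (rule eventually_compose_filterlim)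
  moreover have "sqrt (real n) ^ 4 = real n ^ 2" for n
    using power_mult[of "sqrt (real n)" 2 2] by simp
  ultimately have "\<forall>\<^sub>F n in sequentially. norm (exp (- (c * \<omega> (sqrt (real n))))) \<le> inverse (real n ^ 2)"
    by simp
  then show ?thesis
    by (rule summable_comparison_test_ev) (rule inverse_power_summable, simp)
qed

text \<open>Inside the disc of radius \<open>R / 3 * sqrt (m + n + 1)\<close> the trivial bound on the Wigner transform
  suffices, by the doubling property; outside of it, the Gaussian decay dominates the weight.\<close>

lemma herm_wigner_weighted_le:
  fixes \<eta> :: "real \<Rightarrow> real"
  assumes mono: "mono_on {0..} \<eta>" and nonneg: "\<And>t. 0 \<le> t \<Longrightarrow> 0 \<le> \<eta> t"
    and quad: "\<And>t. 0 \<le> t \<Longrightarrow> \<eta> t \<le> a * t\<^sup>2 + B" and B: "0 \<le> B" and a: "0 < a" "a < 1 / 2"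
    and R: "15 / (1 - 2 * a) \<le> R"
    and dbl: "\<And>t. 0 \<le> t \<Longrightarrow> \<eta> (R * t) \<le> K * \<eta> t + D" and K: "1 \<le> K"
  shows "cmod (herm_wigner m n q p) * exp (2 * (\<eta> \<bar>q\<bar> + \<eta> \<bar>p\<bar>))
    \<le> 2 * exp (4 * B + 4 * K * \<eta> 1 + 4 * \<bar>D\<bar>) * exp (4 * K * (\<eta> (sqrt (real m)) + \<eta> (sqrt (real n))))"
proof -
  define r where "r = sqrt (q\<^sup>2 + p\<^sup>2)"
  define s where "s = sqrt (real m + real n + 1)"
  have r0: "0 \<le> r" and r2: "r\<^sup>2 = q\<^sup>2 + p\<^sup>2" by (simp_all add: r_def)
  have s0: "0 < s" and s2: "s\<^sup>2 = real m + real n + 1" by (simp_all add: s_def)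
  have R15: "15 \<le> R * (1 - 2 * a)" using R a by (simp add: field_simps)
  have R0: "15 \<le> R"
  proof -
    have "15 \<le> 15 / (1 - 2 * a)" using a by (simp add: field_simps)
    with R show ?thesis by linarith
  qed
  have \<eta>_nonneg: "0 \<le> \<eta> 1" "0 \<le> \<eta> (sqrt (real m))" "0 \<le> \<eta> (sqrt (real n))"
    by (auto intro: nonneg)
  have pos: "0 \<le> 4 * K * \<eta> 1" "0 \<le> 4 * K * (\<eta> (sqrt (real m)) + \<eta> (sqrt (real n)))"
    using \<eta>_nonneg K by auto
  have exponent: ?thesis
    if "cmod (herm_wigner m n q p) \<le> 2 * exp x"
      and "x + 2 * (\<eta> \<bar>q\<bar> + \<eta> \<bar>p\<bar>) \<le> 4 * B + 4 * K * \<eta> 1 + 4 * \<bar>D\<bar> + 4 * K * (\<eta> (sqrt (real m)) + \<eta> (sqrt (real n)))"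
    for x
  proof -
    have "cmod (herm_wigner m n q p) * exp (2 * (\<eta> \<bar>q\<bar> + \<eta> \<bar>p\<bar>)) \<le> 2 * exp x * exp (2 * (\<eta> \<bar>q\<bar> + \<eta> \<bar>p\<bar>))"
      using that(1) by (intro mult_right_mono) auto
    also have "\<dots> = 2 * exp (x + 2 * (\<eta> \<bar>q\<bar> + \<eta> \<bar>p\<bar>))"
      by (simp add: exp_add)
    also have "\<dots> \<le> 2 * exp (4 * B + 4 * K * \<eta> 1 + 4 * \<bar>D\<bar> + 4 * K * (\<eta> (sqrt (real m)) + \<eta> (sqrt (real n))))"
      using that(2) by simp
    also have "\<dots> = 2 * exp (4 * B + 4 * K * \<eta> 1 + 4 * \<bar>D\<bar>) * exp (4 * K * (\<eta> (sqrt (real m)) + \<eta> (sqrt (real n))))"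
      by (simp add: exp_add)
    finally show ?thesis .
  qed
  show ?thesis
  proof (cases "r \<le> R / 3 * s")
    case True
    \<comment> \<open>Here s \<le> 3 M, which explains the threshold R / 3: the point lies within
      radius R M. As M is one of three numbers, its weight is at most the sum of their
      weights.\<close>
    define M where "M = Max {sqrt (real m), sqrt (real n), 1}"
    have M: "sqrt (real m) \<le> M" "sqrt (real n) \<le> M" "1 \<le> M"
      and M_cases: "M = sqrt (real m) \<or> M = sqrt (real n) \<or> M = 1"
      by (auto simp: M_def max_def)
    have "real m \<le> M\<^sup>2" "real n \<le> M\<^sup>2" "1 \<le> M\<^sup>2"
      using M by (auto simp: real_sqrt_le_iff' sqrt_le_D)
    then have "s\<^sup>2 \<le> (3 * M)\<^sup>2"
      by (simp add: s2 power_mult_distrib)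
    then have "s \<le> 3 * M"
      by (rule power2_le_imp_le) (use M in simp)
    then have "R / 3 * s \<le> R / 3 * (3 * M)"
      using R0 by (intro mult_left_mono) auto
    with True have rM: "r \<le> R * M" by simp
    have "\<eta> M \<le> \<eta> (sqrt (real m)) + \<eta> (sqrt (real n)) + \<eta> 1"
      using M_cases \<eta>_nonneg by auto
    then have KM: "K * \<eta> M \<le> K * (\<eta> (sqrt (real m)) + \<eta> (sqrt (real n)) + \<eta> 1)"
      using K by (intro mult_left_mono) auto
    have "\<eta> x \<le> K * (\<eta> (sqrt (real m)) + \<eta> (sqrt (real n)) + \<eta> 1) + \<bar>D\<bar>" if "0 \<le> x" "x \<le> r" for x
    proof -
      have "\<eta> x \<le> \<eta> (R * M)"
        using that rM R0 M by (intro mono_onD[OF mono]) auto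
      also have "\<dots> \<le> K * \<eta> M + D" using M by (intro dbl) simp
      finally show ?thesis using KM by linarith
    qed
    \<comment> \<open>Two coordinates and the factor 2 in the exponent give the constant 4 in front
      of K.\<close>
    from add_mono[OF this[OF abs_ge_zero, of q] this[OF abs_ge_zero, of p]]
    have "\<eta> \<bar>q\<bar> + \<eta> \<bar>p\<bar> \<le> 2 * (K * (\<eta> (sqrt (real m)) + \<eta> (sqrt (real n)) + \<eta> 1) + \<bar>D\<bar>)"
      by (simp add: r_def)
    from mult_left_mono[OF this, of 2]
    have "2 * (\<eta> \<bar>q\<bar> + \<eta> \<bar>p\<bar>) \<le> 4 * (K * (\<eta> (sqrt (real m)) + \<eta> (sqrt (real n)) + \<eta> 1) + \<bar>D\<bar>)"
      by simp
    also have "\<dots> = 4 * K * \<eta> 1 + 4 * \<bar>D\<bar> + 4 * K * (\<eta> (sqrt (real m)) + \<eta> (sqrt (real n)))"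
      by (simp add: algebra_simps)
    finally show ?thesis
      using B norm_herm_wigner_le_2[of m n q p] by (intro exponent[of 0]) auto
  next
    \<comment> \<open>Now s < 3 r / R and s \<le> r, so s (4 r + s) \<le> (3 r / R) (5 r). This is
      the origin of 15, and R is large enough for the result to fit into (1 - 2 a) r^2.\<close>
    case False
    then have sr: "s \<le> 3 * r / R" using R0 by (simp add: field_simps)
    have sr': "s \<le> r"
    proof -
      have "3 * r / R \<le> r" using R0 r0 mult_right_mono[of 3 R r] by (simp add: field_simps)
      with sr show ?thesis by linarith
    qed
    have "4 * r * s + s\<^sup>2 = s * (4 * r + s)" by (simp add: power2_eq_square algebra_simps)
    also have "\<dots> \<le> (3 * r / R) * (5 * r)"
      using sr sr' s0 r0 R0 by (intro mult_mono) auto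
    also have "\<dots> = 15 / R * r\<^sup>2" by (simp add: power2_eq_square)
    also have "\<dots> \<le> (1 - 2 * a) * r\<^sup>2"
      using R15 R0 by (intro mult_right_mono) (auto simp: field_simps)
    finally have 1: "- r\<^sup>2 + 4 * r * s + s\<^sup>2 \<le> - 2 * a * r\<^sup>2"
      by (simp add: algebra_simps)
    have 2: "2 * (\<eta> \<bar>q\<bar> + \<eta> \<bar>p\<bar>) \<le> 2 * a * r\<^sup>2 + 4 * B"
      using quad[of "\<bar>q\<bar>"] quad[of "\<bar>p\<bar>"] by (simp add: r2 algebra_simps)
    show ?thesis
    proof (rule exponent)
      show "cmod (herm_wigner m n q p) \<le> 2 * exp (- r\<^sup>2 + 4 * r * s + s\<^sup>2)"
        unfolding r_def s_def by (rule norm_herm_wigner_le)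
      show "- r\<^sup>2 + 4 * r * s + s\<^sup>2 + 2 * (\<eta> \<bar>q\<bar> + \<eta> \<bar>p\<bar>)
        \<le> 4 * B + 4 * K * \<eta> 1 + 4 * \<bar>D\<bar> + 4 * K * (\<eta> (sqrt (real m)) + \<eta> (sqrt (real n)))"
        using 1 2 pos abs_ge_zero[of D] by linarith
    qed
  qed
qed

text \<open>Of the k + 1 units of decay, k cancel the growth and one is left over to make the double
  series converge.\<close>

lemma le_weighted_of_exp:
  fixes H :: real
  assumes "H * exp E \<le> K * exp (k * (x + y))"
  shows "H * (exp (- ((k + 1) * x)) * exp (- ((k + 1) * y))) \<le> K * exp (- E) * (exp (- x) * exp (- y))"
proof -
  have "H * exp E * exp (- E - (k + 1) * (x + y)) \<le> K * exp (k * (x + y)) * exp (- E - (k + 1) * (x + y))"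
    using assms by (rule mult_right_mono) simp
  then show ?thesis
    by (simp add: mult.assoc mult_exp_exp algebra_simps)
qed

section \<open>A uniform exponent over the weight class\<close>

theorem proposition4p2:
  fixes \<omega> :: "real \<Rightarrow> real"
  assumes "weight_function \<omega>"
    and "quadratic_limsup \<omega> < ereal (1 / 2)"
  shows "\<exists>Cbar::real. 0 < Cbar \<and>
    (\<forall>\<eta>\<in>weight_class \<omega>. quadratic_limsup \<eta> \<le> quadratic_limsup \<omega> \<longrightarrow>
      (\<exists>C::real. 0 < C \<and>
        (\<forall>D \<rho> ev \<psi>. diagonal_psd_operator D \<rho> ev \<psi> \<and> (\<forall>n. hermite_fun n \<in> D) \<longrightarrow>
          (SUP q. SUP p. ennreal (cmod (wigner ev \<psi> q p) * exp (2 * (\<eta> \<bar>q\<bar> + \<eta> \<bar>p\<bar>))))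
            \<le> ennreal C *
              (SUP m. SUP n. ennreal (cmod (density_matrix \<rho> m n) *
                 exp (Cbar * (\<eta> (sqrt (real m)) + \<eta> (sqrt (real n)))))))))"
proof -
  have mono: "mono_on {0..} \<omega>" and nonneg: "\<And>t. 0 \<le> t \<Longrightarrow> 0 \<le> \<omega> t" and ln: "ln \<in> o[at_top](\<omega>)"
    using assms(1) by (auto simp: weight_function_def)
  obtain a0 where a0: "quadratic_limsup \<omega> < ereal a0" "ereal a0 < ereal (1 / 2)"
    using ereal_dense2[OF assms(2)] by blast
  \<comment> \<open>The maximum with 1/4 makes \<open>a\<close> visibly positive while keeping it
    below 1/2.\<close>
  define a where "a = max a0 (1 / 4)"
  have a: "quadratic_limsup \<omega> < ereal a" "0 < a" "a < 1 / 2"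
    using a0 by (auto simp: a_def less_max_iff_disj elim: less_le_trans)
  obtain K D where K: "1 \<le> K" and dbl: "\<And>t. 0 \<le> t \<Longrightarrow> \<omega> (2 * t) \<le> K * \<omega> t + D"
    using weight_function_doubling[OF assms(1)] by blast
  \<comment> \<open>The ratio R is taken as a power of 2, so that iterated doubling controls the
    weight at R t.\<close>
  obtain k :: nat where "15 / (1 - 2 * a) < 2 ^ k"
    using real_arch_pow[of 2] by auto
  then have k: "15 / (1 - 2 * a) \<le> 2 ^ k" by simp
  have K1: "1 \<le> K ^ k" using K by simp
  \<comment> \<open>The term 4 K^k is the growth inside the disc and the summand 1 pays for
    summability. All ingredients are fixed before \<eta> is chosen, hence the uniformity.\<close>
  define Cbar where "Cbar = 4 * K ^ k + 1"
  have Cbar: "0 < Cbar" using K1 by (simp add: Cbar_def)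
  show ?thesis
  proof (rule exI[of _ Cbar], intro conjI Cbar ballI impI)
    fix \<eta> assume "\<eta> \<in> weight_class \<omega>" and lim: "quadratic_limsup \<eta> \<le> quadratic_limsup \<omega>"
    then obtain c where c: "0 < c" and \<eta>: "\<And>t. 0 \<le> t \<Longrightarrow> \<eta> t = c * \<omega> t"
      by (auto simp: weight_class_def)
    have \<eta>_mono: "mono_on {0..} \<eta>"
      using c by (intro mono_onI) (auto simp: \<eta> intro: mono_onD[OF mono])
    have \<eta>_nonneg: "0 \<le> \<eta> t" if "0 \<le> t" for t
      using c nonneg that by (simp add: \<eta>)
    obtain B where B: "0 \<le> B" "\<And>t. 0 \<le> t \<Longrightarrow> \<eta> t \<le> a * t\<^sup>2 + B"
      using quadratic_bound[OF \<eta>_mono \<eta>_nonneg le_less_trans[OF lim a(1)] a(2)] by blast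
    \<comment> \<open>Rescaling leaves K unchanged and multiplies only D by c. Likewise the same
      \<open>a\<close> serves for \<eta>, by the hypothesis on its limsup.\<close>
    have "\<eta> (2 * t) \<le> K * \<eta> t + c * D" if "0 \<le> t" for t
      using mult_left_mono[OF dbl[OF that], of c] c that by (simp add: \<eta> algebra_simps)
    from doubling_power[of \<eta>, OF this K]
    obtain D' where D': "\<And>t. 0 \<le> t \<Longrightarrow> \<eta> (2 ^ k * t) \<le> K ^ k * \<eta> t + D'" by blast
    define v where "v = (\<lambda>n. exp (- \<eta> (sqrt (real n))))"
    define w where "w = (\<lambda>n. exp (- (Cbar * \<eta> (sqrt (real n)))))"
    define K0 where "K0 = 2 * exp (4 * B + 4 * K ^ k * \<eta> 1 + 4 * \<bar>D'\<bar>)"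
    have v: "summable v"
      using summable_exp_weight[OF ln nonneg c] by (simp add: v_def \<eta>)
    have w: "summable w"
      using summable_exp_weight[OF ln nonneg, of "Cbar * c"] c Cbar by (simp add: w_def \<eta> mult.assoc)
    have v_pos: "0 < suminf v"
      using v by (intro suminf_pos) (auto simp: v_def)
    define C where "C = K0 * (suminf v)\<^sup>2 / (2 * pi)"
    have C: "0 < C"
      using v_pos by (simp add: C_def K0_def)
    have herm: "cmod (herm_wigner m n q p) * (w m * w n) \<le>
        K0 * exp (- (2 * (\<eta> \<bar>q\<bar> + \<eta> \<bar>p\<bar>))) * (v m * v n)" for m n q p
      unfolding w_def v_def Cbar_def K0_def
      by (rule le_weighted_of_exp, rule herm_wigner_weighted_le[OF \<eta>_mono \<eta>_nonneg B(2,1) a(2,3) k D' K1])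
    show "\<exists>C>0. \<forall>D \<rho> ev \<psi>. diagonal_psd_operator D \<rho> ev \<psi> \<and> (\<forall>n. hermite_fun n \<in> D) \<longrightarrow>
          (SUP q. SUP p. ennreal (cmod (wigner ev \<psi> q p) * exp (2 * (\<eta> \<bar>q\<bar> + \<eta> \<bar>p\<bar>))))
            \<le> ennreal C *
              (SUP m. SUP n. ennreal (cmod (density_matrix \<rho> m n) *
                 exp (Cbar * (\<eta> (sqrt (real m)) + \<eta> (sqrt (real n))))))"
    proof (intro exI[of _ C] conjI allI impI C)
      fix D \<rho> \<alpha> \<psi>
      assume "diagonal_psd_operator D \<rho> \<alpha> \<psi> \<and> (\<forall>n. hermite_fun n \<in> D)"
      then have \<rho>: "diagonal_psd_operator D \<rho> \<alpha> \<psi>" and D: "\<And>n. hermite_fun n \<in> D" by auto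
      let ?d = "\<lambda>m n. ennreal (cmod (density_matrix \<rho> m n) * exp (Cbar * (\<eta> (sqrt (real m)) + \<eta> (sqrt (real n)))))"
      define S where "S = (SUP m. SUP n. ?d m n)"
      have le: "ennreal (cmod (wigner \<alpha> \<psi> q p) * exp (2 * (\<eta> \<bar>q\<bar> + \<eta> \<bar>p\<bar>))) \<le> ennreal C * S"
        (is "ennreal (_ * exp ?E) \<le> _") for q p
      proof (cases S)
        case (real M)
        have dens: "cmod (density_matrix \<rho> n n) \<le> M * (w n)\<^sup>2" for n
        proof -
          \<comment> \<open>Both indices of the supremum are set to n, since only diagonal entries
            are to be bounded.\<close>
          have "?d n n \<le> S"
            unfolding S_def by (intro SUP_upper2[of n]) auto
          then have "cmod (density_matrix \<rho> n n) * exp (Cbar * (\<eta> (sqrt (real n)) + \<eta> (sqrt (real n)))) \<le> M"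
            using real by simp
          then have "cmod (density_matrix \<rho> n n) \<le> M / exp (Cbar * (\<eta> (sqrt (real n)) + \<eta> (sqrt (real n))))"
            by (simp add: field_simps)
          also have "\<dots> = M * exp (- (Cbar * (\<eta> (sqrt (real n)) + \<eta> (sqrt (real n)))))"
            by (simp add: exp_minus divide_inverse)
          also have "\<dots> = M * (w n)\<^sup>2"
            unfolding w_def power2_eq_square mult_exp_exp by (simp add: distrib_left)
          finally show ?thesis .
        qed
        have "cmod (wigner \<alpha> \<psi> q p) \<le> M * (K0 * exp (- ?E)) * (suminf v)\<^sup>2 / (2 * pi)"
          by (rule norm_wigner_le[OF \<rho> D _ _ w dens _ _ v herm])
             (use real in \<open>auto simp: w_def v_def K0_def\<close>)
        then have "cmod (wigner \<alpha> \<psi> q p) * exp ?E \<le> M * (K0 * exp (- ?E)) * (suminf v)\<^sup>2 / (2 * pi) * exp ?E"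
          by (rule mult_right_mono) simp
        also have "\<dots> = C * M"
          by (simp add: C_def mult_exp_exp)
        finally have "ennreal (cmod (wigner \<alpha> \<psi> q p) * exp ?E) \<le> ennreal (C * M)"
          by (rule ennreal_leI)
        also have "\<dots> = ennreal C * S"
          using real C by (simp add: ennreal_mult')
        finally show "ennreal (cmod (wigner \<alpha> \<psi> q p) * exp ?E) \<le> ennreal C * S" .
      next
        \<comment> \<open>Positivity of C keeps the product infinite, so the inequality is
          trivial.\<close>
        case top
        then show "ennreal (cmod (wigner \<alpha> \<psi> q p) * exp ?E) \<le> ennreal C * S"
          using C by (simp add: ennreal_mult_top)
      qed
      show "(SUP q. SUP p. ennreal (cmod (wigner \<alpha> \<psi> q p) * exp (2 * (\<eta> \<bar>q\<bar> + \<eta> \<bar>p\<bar>))))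
          \<le> ennreal C * (SUP m. SUP n. ?d m n)"
        unfolding S_def[symmetric] by (intro SUP_least le)
    qed
  qed
qed

end
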